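(* Let Algorithm 1 be run on the convex program $\min f(x)$ s.t. $g(x)\le 0$ (algorithm, data and standing assumptions as in the context). For given tolerances $\overline\delta>0$ and $\overline\varepsilon>0$, after at most $$\widetilde M:=2\left\lceil\max\left\{\frac{2^{2/3}d_0^{4/3}}{\overline\delta^{2/3}\tau\left(\eta\sqrt{1-\sigma}\right)^{2/3}},\ \frac{2^{2/3}d_0^2}{\overline\varepsilon^{2/3}\tau\left(\eta(1-\sigma^2)\right)^{2/3}}\right\}\right\rceil+\left\lceil\frac{\max\left\{\log^+\!\left((1+1/\sigma)\overline\rho/(\overline\delta\lambda_1)\right),\ \log^+\!\left(\overline\rho^2/(2\overline\varepsilon\lambda_1)\right)\right\}}{\log(1/(1-\tau))}\right\rceil$$ iterations, Algorithm 1 finds $((x,y),v,\varepsilon)$ such that $$v\in\partial_\varepsilon\left(\overline{\mathscr L}(\cdot,y)-\overline{\mathscr L}(x,\cdot)\right)(x,y),\qquad \|v\|\le\overline\delta,\qquad \varepsilon\le\overline\varepsilon,$$ with the property that $((x,y),(p,q),\varepsilon)$, where $(p,q):=v\in\mathbb R^n\times\mathbb R^m$, also satisfies $$p\in\partial_{x,\varepsilon'}\overline{\mathscr L}(x,y),\quad g(x)+q\le 0,\quad y\ge 0,\quad \langle y,g(x)+q\rangle\ge-\varepsilon,\quad \|(p,q)\|\le\overline\delta,\quad \varepsilon\le\overline\varepsilon,$$ where $\varepsilon':=\varepsilon+\langle y,g(x)+q\rangle$.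
   Context: Notation: $\langle\cdot,\cdot\rangle$, $\|\cdot\|$ are Euclidean; for vectors, $(\cdot)_+$, $(\cdot)_-$, $|\cdot|$ and inequalities are componentwise with $t_+=\max\{t,0\}$, $t_-=\max\{-t,0\}$; $\log^+ t=\max\{\log t,0\}$. Problem: $\min f(x)$ s.t. $g(x)\le 0$, with $f:\mathbb R^n\to\mathbb R$, $g=(g_1,\dots,g_m):\mathbb R^n\to\mathbb R^m$. Standing assumptions: (O.1) $f,g_1,\dots,g_m$ are convex and $C^2$; (O.2) the Hessians of $f,g_1,\dots,g_m$ are Lipschitz continuous with constants $L_0,L_1,\dots,L_m$, and $L_i\ne0$ for some $i\ge1$; (O.3) there is $(x,y)\in\mathbb R^n\times\mathbb R^m$ satisfying the KKT conditions $\nabla f(x)+\nabla g(x)y=0$, $g(x)\le0$, $y\ge0$, $\langle y,g(x)\rangle=0$. Here $\nabla g(x)$ is the $n\times m$ matrix with columns $\nabla g_i(x)$. $L_g:=(L_1,\dots,L_m)$. $\mathbf S(x,y):=(\nabla f(x)+\nabla g(x)y,\,-g(x))$. For $\mathring z\in\mathbb R^n\times\mathbb R^m$, $\lambda\in\mathbb R$, $z=(x,y)\in\mathbb R^n\times\mathbb R^m_+$: $\Psi_{\mathbf S,\mathring z,\lambda}(z):=\min_{w\in\mathbb R^m_+}\|\lambda(\mathbf S(z)-(0,w))+z-\mathring z\|^2+2\lambda\langle y,w\rangle$. For $\lambda>0$ and $\theta'\ge0$, $\mathcal N_{\theta'}(\mathring z,\lambda)$ is the set of $(x,y)\in\mathbb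 R^n\times\mathbb R^m_+$ with $\lambda\left(\frac{L_0+\langle L_g,|y|\rangle}{2}+\frac{2\|L_g\|}{3}\rho\right)\rho\le\theta'$, where $\rho=\sqrt{\Psi_{\mathbf S,\mathring z,\lambda}(x,y)}$. For $y\in\mathbb R^m$, $\alpha>0$, $\rho(y,\alpha)$ is the largest root $\rho$ of $\left(\frac{L_0+\langle L_g,|y|\rangle}{2}+\frac{2\|L_g\|}{3}\rho\right)\rho=\alpha$. For $\tilde x\in\mathbb R^n$, $f_{[\tilde x]}$ and $g_{[\tilde x]}=(g_{1,[\tilde x]},\dots,g_{m,[\tilde x]})$ are the second-order Taylor polynomials of $f$ and of the components of $g$ at $\tilde x$. Algorithm 1. Initialization: choose $(x_0,y_0)=(\tilde x_1,\tilde y_1)\in\mathbb R^n\times\mathbb R^m_+$, $0<\sigma<1$, $0<\theta\le1/4$; let $h$ be the positive root of $\theta(1+h')(1+h'(1+1/\sigma))^2=1$ (unknown $h'$) and $\tau=h/(1+h)$; choose $\lambda_1>0$ with $(\tilde x_1,\tilde y_1)\in\mathcal N_{\theta^2}((x_0,y_0),\lambda_1)$. It is assumed that $(\tilde x_1,\tilde y_1)$ does not satisfy the KKT conditions. Iteration $k=1,2,\dots$: write $z_{k-1}=(x_{k-1},y_{k-1})$, $\tilde z_k=(\tilde x_k,\tilde y_k)$, $\rho_k=\rho(\tilde y_k,\theta^2/\lambda_k)$. - If $\rho_k\le\sigma\|\tilde z_k-z_{k-1}\|$: $\lambda_{k+1}=(1-\tau)\lambda_k$, $\tilde z_{k+1}=\tilde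 z_k$, $x_k=x_{k-1}-\tau\lambda_k[\nabla f(\tilde x_k)+\nabla g(\tilde x_k)\tilde y_k]$, $y_k=y_{k-1}+\tau[\lambda_kg(\tilde x_k)+(\lambda_kg(\tilde x_k)+y_{k-1})_-]$. - Otherwise: $\lambda_{k+1}=(1-\tau)^{-1}\lambda_k$, $z_k=z_{k-1}$, and $\tilde z_{k+1}$ is the (unique) solution of $\min_{x\in\mathbb R^n}\max_{y\in\mathbb R^m_+} f_{[\tilde x_k]}(x)+\langle y,g_{[\tilde x_k]}(x)\rangle+\frac{\|x-x_k\|^2-\|y-y_k\|^2}{2\lambda_{k+1}}$. Associated quantities for $k\ge1$: $w_k=(g(\tilde x_k)+\lambda_k^{-1}y_{k-1})_-$, $v_k=\mathbf S(\tilde z_k)-(0,w_k)$, $\varepsilon_k=\langle\tilde y_k,w_k\rangle$. Let $A=\{k\ge1:\rho_k\le\sigma\|\tilde z_k-z_{k-1}\|\}$ and let $k_1<k_2<\cdots$ be its elements, indexed by $I=\{i\in\mathbb N:1\le i\le\#A\}$. Ergodic quantities, for $i\in I$: $\Lambda_i=\tau\sum_{j=1}^i\lambda_{k_j}$, $\tilde z_i^a=(\tilde x_i^a,\tilde y_i^a)=\frac1{\Lambda_i}\tau\sum_{j=1}^i\lambda_{k_j}\tilde z_{k_j}$, $v_i^a=\frac1{\Lambda_i}\tau\sum_{j=1}^i\lambda_{k_j}v_{k_j}$, $\varepsilon_i^a=\frac1{\Lambda_i}\tau\sum_{j=1}^i\lambda_{k_j}\left(\varepsilon_{k_j}+\langle\tilde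 z_{k_j}-\tilde z_i^a,v_{k_j}-v_i^a\rangle\right)$. "After at most $\widetilde M$ iterations Algorithm 1 finds $((x,y),v,\varepsilon)$" means that $((x,y),v,\varepsilon)$ is either $(\tilde z_i^a,v_i^a,\varepsilon_i^a)$ for some $i\in I$ with $k_i\le\widetilde M$, or $(\tilde z_k,v_k,\varepsilon_k)$ for some $1\le k\le\widetilde M$. $\mathcal K$ is the set of pairs satisfying the KKT conditions and $d_0$ is the distance from $z_0=(x_0,y_0)$ to $\mathcal K$. Constants: $c:=\frac{L_0+\langle L_g,|y_0|\rangle}{2}+\left[\frac12+\frac{1/2+2\sigma/3}{\sqrt{1-\sigma^2}}\right]d_0\|L_g\|$, $\ \eta:=\frac{\theta^2}{\sigma c}$, $\ \overline\rho:=\dfrac{2\theta^2}{\lambda_1\left(\frac{L_0}{2}+\sqrt{\left(\frac{L_0}{2}\right)^2+\frac{8\|L_g\|\theta^2}{3\lambda_1}}\right)}$. $\overline{\mathscr L}(x,y):=f(x)+\langle y,g(x)\rangle$ if $y\ge0$, and $-\infty$ otherwise. For $y\ge0$, $\overline{\mathscr L}(\cdot,y)-\overline{\mathscr L}(x,\cdot)$ is the function $(x',y')\mapsto\overline{\mathscr L}(x',y)-\overline{\mathscr L}(x,y')$ on $\mathbb R^n\times\mathbb R^m$; $\partial_\varepsilon$ ($\varepsilon\ge0$) is the usual $\varepsilon$-subdifferential of convex analysis, and $\partial_{x,\varepsilon'}\overline{\mathscr L}(x,y)$ is the $\varepsilon'$-subdifferential of $\overline{\mathscr L}(\cdot,y)$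 at $x$. *)

theory Defs
  imports "HOL-Analysis.Analysis"
begin

section \<open>Second-order calculus\<close>

definition gradient :: "('a::euclidean_space \<Rightarrow> real) \<Rightarrow> 'a \<Rightarrow> 'a"
  where "gradient f x = (THE D. GDERIV f x :> D)"

text \<open>The Hessian is a bounded linear map, so that its norm (and hence \<^const>\<open>lipschitz_on\<close>
  for it) refers to the operator norm, not to the Frobenius norm carried by the matrix type.\<close>

definition hessian :: "('a::euclidean_space \<Rightarrow> real) \<Rightarrow> 'a \<Rightarrow> 'a \<Rightarrow>\<^sub>L 'a"
  where "hessian f x = Blinfun (frechet_derivative (gradient f) (at x))"

definition C2 :: "('a::euclidean_space \<Rightarrow> real) \<Rightarrow> bool"
  where "C2 f \<longleftrightarrow> (\<forall>x. f differentiable (at x)) \<and> (\<forall>x. gradient f differentiable (at x)) \<and>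
    continuous_on UNIV (hessian f)"

definition taylor2 :: "'a::euclidean_space \<Rightarrow> ('a \<Rightarrow> real) \<Rightarrow> 'a \<Rightarrow> real"
  where "taylor2 a f x =
    f a + gradient f a \<bullet> (x - a) + (1/2) * ((x - a) \<bullet> blinfun_apply (hessian f a) (x - a))"

definition taylor2_vec :: "'a::euclidean_space \<Rightarrow> ('a \<Rightarrow> real ^ 'm) \<Rightarrow> 'a \<Rightarrow> real ^ 'm"
  where "taylor2_vec a g x = (\<chi> i. taylor2 a (\<lambda>u. g u $ i) x)"

text \<open>The matrix whose columns are the gradients of the components of \<open>g\<close>.\<close>

definition grad_matrix :: "(real ^ 'n \<Rightarrow> real ^ 'm) \<Rightarrow> real ^ 'n \<Rightarrow> real ^ 'm ^ 'n"
  where "grad_matrix g x = (\<chi> j i. gradient (\<lambda>u. g u $ i) x $ j)"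

section \<open>Convex analysis\<close>

definition neg_part :: "real ^ 'm \<Rightarrow> real ^ 'm"
  where "neg_part v = (\<chi> i. max (- (v $ i)) 0)"

definition log_plus :: "real \<Rightarrow> real"
  where "log_plus t = max (ln t) 0"

definition eps_subdifferential :: "real \<Rightarrow> ('a::real_inner \<Rightarrow> ereal) \<Rightarrow> 'a \<Rightarrow> 'a set"
  where "eps_subdifferential \<epsilon> h z = {v. \<forall>z'. h z + ereal (v \<bullet> (z' - z) - \<epsilon>) \<le> h z'}"

text \<open>\<open>(x, y)\<close> solves \<open>min_x max_(y in Y) F x y\<close>: \<open>x\<close> minimizes the inner maximum and \<open>y\<close>
  attains it at \<open>x\<close>.  The supremum is used only where the inner maximum exists.\<close>

definition minimax_solution :: "'b set \<Rightarrow> ('a \<Rightarrow> 'b \<Rightarrow> real) \<Rightarrow> 'a \<times> 'b \<Rightarrow> bool"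
  where "minimax_solution Y F = (\<lambda>(x, y).
    is_arg_min (\<lambda>x'. SUP y'\<in>Y. F x' y') (\<lambda>x'. True) x \<and>
    is_arg_max (F x) (\<lambda>y'. y' \<in> Y) y)"

section \<open>The convex program\<close>

locale convex_program_data =
  fixes f :: "real ^ 'n \<Rightarrow> real"
    and g :: "real ^ 'n \<Rightarrow> real ^ 'm"
    and L0 :: real
    and Lg :: "real ^ 'm"
begin

definition grad_lagrangian :: "real ^ 'n \<Rightarrow> real ^ 'm \<Rightarrow> real ^ 'n"
  where "grad_lagrangian x y = gradient f x + grad_matrix g x *v y"

definition KKT :: "((real ^ 'n) \<times> (real ^ 'm)) set"
  where "KKT = {(x, y). grad_lagrangian x y = 0 \<and> g x \<le> 0 \<and> 0 \<le> y \<and> y \<bullet> g x = 0}"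

definition S :: "(real ^ 'n) \<times> (real ^ 'm) \<Rightarrow> (real ^ 'n) \<times> (real ^ 'm)"
  where "S = (\<lambda>(x, y). (grad_lagrangian x y, - g x))"

definition Lbar :: "real ^ 'n \<Rightarrow> real ^ 'm \<Rightarrow> ereal"
  where "Lbar x y = (if 0 \<le> y then ereal (f x + y \<bullet> g x) else - \<infinity>)"

definition \<Psi> :: "(real ^ 'n) \<times> (real ^ 'm) \<Rightarrow> real \<Rightarrow> (real ^ 'n) \<times> (real ^ 'm) \<Rightarrow> real"
  where "\<Psi> z0 \<mu> z = (INF w\<in>{w. 0 \<le> w}.
    (norm (\<mu> *\<^sub>R (S z - (0, w)) + z - z0))\<^sup>2 + 2 * \<mu> * (snd z \<bullet> w))"

definition quad :: "real ^ 'm \<Rightarrow> real \<Rightarrow> real"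
  where "quad y r = ((L0 + Lg \<bullet> \<bar>y\<bar>) / 2 + (2 * norm Lg / 3) * r) * r"

definition N :: "real \<Rightarrow> (real ^ 'n) \<times> (real ^ 'm) \<Rightarrow> real \<Rightarrow> ((real ^ 'n) \<times> (real ^ 'm)) set"
  where "N \<theta>' z0 \<mu> = {z. 0 \<le> snd z \<and> \<mu> * quad (snd z) (sqrt (\<Psi> z0 \<mu> z)) \<le> \<theta>'}"

definition \<rho> :: "real ^ 'm \<Rightarrow> real \<Rightarrow> real"
  where "\<rho> y \<alpha> = (GREATEST r. quad y r = \<alpha>)"

end

locale convex_program = convex_program_data f g L0 Lg
  for f :: "real ^ 'n \<Rightarrow> real" and g :: "real ^ 'n \<Rightarrow> real ^ 'm" and L0 Lg +
  assumes f_convex: "convex_on UNIV f"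
    and g_convex: "\<And>i. convex_on UNIV (\<lambda>x. g x $ i)"
    and f_C2: "C2 f"
    and g_C2: "\<And>i. C2 (\<lambda>x. g x $ i)"
    and f_hessian_lipschitz: "L0-lipschitz_on UNIV (hessian f)"
    and g_hessian_lipschitz: "\<And>i. (Lg $ i)-lipschitz_on UNIV (hessian (\<lambda>x. g x $ i))"
    and Lg_nonzero: "\<exists>i. Lg $ i \<noteq> 0"
    and KKT_nonempty: "KKT \<noteq> {}"

section \<open>The algorithm\<close>

text \<open>\<open>x\<close>, \<open>y\<close> are indexed from 0; \<open>xt\<close>, \<open>yt\<close> (the tilde iterates) and the stepsizes \<open>lam\<close>
  from 1, their value at 0 being irrelevant.\<close>

locale algorithm1_data = convex_program_data f g L0 Lg
  for f :: "real ^ 'n \<Rightarrow> real" and g :: "real ^ 'n \<Rightarrow> real ^ 'm" and L0 Lg +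
  fixes \<sigma> \<theta> \<tau> :: real
    and lam :: "nat \<Rightarrow> real"
    and x :: "nat \<Rightarrow> real ^ 'n" and y :: "nat \<Rightarrow> real ^ 'm"
    and xt :: "nat \<Rightarrow> real ^ 'n" and yt :: "nat \<Rightarrow> real ^ 'm"
begin

definition z :: "nat \<Rightarrow> (real ^ 'n) \<times> (real ^ 'm)"
  where "z k = (x k, y k)"

definition zt :: "nat \<Rightarrow> (real ^ 'n) \<times> (real ^ 'm)"
  where "zt k = (xt k, yt k)"

definition A :: "nat set"
  where "A = {k. 1 \<le> k \<and> \<rho> (yt k) (\<theta>\<^sup>2 / lam k) \<le> \<sigma> * norm (zt k - z (k - 1))}"

definition extragradient_step :: "nat \<Rightarrow> bool"
  where "extragradient_step k \<longleftrightarrow>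
    lam (k + 1) = (1 - \<tau>) * lam k \<and>
    xt (k + 1) = xt k \<and> yt (k + 1) = yt k \<and>
    x k = x (k - 1) - (\<tau> * lam k) *\<^sub>R grad_lagrangian (xt k) (yt k) \<and>
    y k = y (k - 1) + \<tau> *\<^sub>R (lam k *\<^sub>R g (xt k) + neg_part (lam k *\<^sub>R g (xt k) + y (k - 1)))"

definition newton_step :: "nat \<Rightarrow> bool"
  where "newton_step k \<longleftrightarrow>
    lam (k + 1) = inverse (1 - \<tau>) * lam k \<and>
    x k = x (k - 1) \<and> y k = y (k - 1) \<and>
    minimax_solution {u. 0 \<le> u}
      (\<lambda>x' y'. taylor2 (xt k) f x' + y' \<bullet> taylor2_vec (xt k) g x'
         + ((norm (x' - x k))\<^sup>2 - (norm (y' - y k))\<^sup>2) / (2 * lam (k + 1)))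
      (xt (k + 1), yt (k + 1))"

definition w :: "nat \<Rightarrow> real ^ 'm"
  where "w k = neg_part (g (xt k) + inverse (lam k) *\<^sub>R y (k - 1))"

definition v :: "nat \<Rightarrow> (real ^ 'n) \<times> (real ^ 'm)"
  where "v k = S (zt k) - (0, w k)"

definition eps :: "nat \<Rightarrow> real"
  where "eps k = yt k \<bullet> w k"

text \<open>\<open>kk i\<close> is the \<open>i\<close>-th smallest element of \<open>A\<close>, counted from 1; meaningful for \<open>i \<in> I\<close>.\<close>

definition kk :: "nat \<Rightarrow> nat"
  where "kk i = enumerate A (i - 1)"

definition I :: "nat set"
  where "I = {i. 1 \<le> i \<and> (finite A \<longrightarrow> i \<le> card A)}"

definition \<Lambda> :: "nat \<Rightarrow> real"
  where "\<Lambda> i = \<tau> * (\<Sum>j=1..i. lam (kk j))"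

definition zt_erg :: "nat \<Rightarrow> (real ^ 'n) \<times> (real ^ 'm)"
  where "zt_erg i = (\<tau> / \<Lambda> i) *\<^sub>R (\<Sum>j=1..i. lam (kk j) *\<^sub>R zt (kk j))"

definition v_erg :: "nat \<Rightarrow> (real ^ 'n) \<times> (real ^ 'm)"
  where "v_erg i = (\<tau> / \<Lambda> i) *\<^sub>R (\<Sum>j=1..i. lam (kk j) *\<^sub>R v (kk j))"

definition eps_erg :: "nat \<Rightarrow> real"
  where "eps_erg i = (\<tau> / \<Lambda> i) *
    (\<Sum>j=1..i. lam (kk j) * (eps (kk j) + (zt (kk j) - zt_erg i) \<bullet> (v (kk j) - v_erg i)))"

definition found_within :: "int \<Rightarrow> (((real ^ 'n) \<times> (real ^ 'm)) \<times> ((real ^ 'n) \<times> (real ^ 'm)) \<times> real) set"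
  where "found_within M =
    {(zt_erg i, v_erg i, eps_erg i) | i. i \<in> I \<and> int (kk i) \<le> M} \<union>
    {(zt k, v k, eps k) | k. 1 \<le> k \<and> int k \<le> M}"

end

locale algorithm1 = convex_program f g L0 Lg + algorithm1_data f g L0 Lg \<sigma> \<theta> \<tau> lam x y xt yt
  for f :: "real ^ 'n \<Rightarrow> real" and g :: "real ^ 'n \<Rightarrow> real ^ 'm" and L0 Lg
    and \<sigma> \<theta> \<tau> lam x y xt yt +
  fixes h :: real
  assumes y0_nonneg: "0 \<le> y 0"
    and xt1: "xt 1 = x 0" and yt1: "yt 1 = y 0"
    and \<sigma>_bounds: "0 < \<sigma>" "\<sigma> < 1"
    and \<theta>_bounds: "0 < \<theta>" "\<theta> \<le> 1/4"
    and h_pos: "0 < h"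
    and h_root: "\<theta> * (1 + h) * (1 + h * (1 + 1/\<sigma>))\<^sup>2 = 1"
    and \<tau>_eq: "\<tau> = h / (1 + h)"
    and lam1_pos: "0 < lam 1"
    and start_N: "zt 1 \<in> N (\<theta>\<^sup>2) (z 0) (lam 1)"
    and start_not_KKT: "zt 1 \<notin> KKT"
    and step: "\<And>k. 1 \<le> k \<Longrightarrow> if k \<in> A then extragradient_step k else newton_step k"

end

theory Submission
  imports Defs
begin

text \<open>The subproblem solved in a Newton step is a regularized quadratic model of the saddle-point
  problem. Its operator is strongly monotone, so the displacement is bounded by the old residual
  \<open>sqrt \<Psi>\<close>, and the Taylor error is then quadratic in that residual; hence the Newton step takes
  \<open>N \<theta>\<close> into \<open>N (\<theta>\<^sup>2)\<close>. Since \<open>\<theta> (1 + h) (1 + h (1 + 1/\<sigma>))\<^sup>2 = 1\<close>, increasing the stepsize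
  moves from \<open>N (\<theta>\<^sup>2)\<close> to \<open>N \<theta>\<close> only, so every iterate stays in \<open>N (\<theta>\<^sup>2)\<close>.
  The steps with index in \<open>A\<close> are therefore relaxed hybrid proximal extragradient steps. Their Fejer
  inequality bounds \<open>\<Sum> \<parallel>zt k - z (k - 1)\<parallel>\<^sup>2\<close>, while the definition of \<open>A\<close> gives the large-step
  inequality \<open>\<eta> \<le> lam k * \<parallel>zt k - z (k - 1)\<parallel>\<close>; so after \<open>i\<close> such steps the sum of the stepsizes
  is at least of order \<open>i\<close> to the power \<open>3/2\<close>, which makes the ergodic residuals small.
  If on the contrary too few of the first \<open>M\<close> steps have index in \<open>A\<close>, the stepsize has been
  increased so often that the iterate at the last Newton step already meets the tolerances.\<close>

section \<open>Functions with Lipschitz continuous Hessian\<close>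

text \<open>The neighborhoods are shaped so that the error analysis reproduces them. In
  \<open>quad\<close> the weight 2/3 is 1/2 + 1/6: one half pays for the change of
  \<open>Lg \<bullet> \<bar>y\<bar>\<close> during a Newton step, one sixth for the cubic Taylor
  remainder of the constraints. The relation \<tau> = h / (1 + h) makes the stepsize factors of the
  two kinds of steps reciprocal, so the stepsize is known from the number of steps in
  \<open>A\<close> alone. The obstacle is that a normal vector of the orthant at an iterate is
  available only up to a defect of complementarity. \<Psi> minimizes over such vectors
  \<open>w\<close> and charges the defect; the same defect is the error \<open>eps k\<close> of the
  subdifferential inclusion. One vector \<open>w k\<close> thus serves the residual, the update of
  \<open>z\<close> and the certificate.\<close>

lemma gderiv_gradient:
  fixes f :: "'a::euclidean_space \<Rightarrow> real"
  assumes "f differentiable (at x)"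
  shows "GDERIV f x :> gradient f x"
proof -
  obtain f' where f': "(f has_derivative f') (at x)"
    using assms unfolding differentiable_def by blast
  interpret bounded_linear f' using f' by (rule has_derivative_bounded_linear)
  \<comment> \<open>The Riesz representative of the derivative, assembled from its values on the
    basis.\<close>
  define D where "D = (\<Sum>b\<in>Basis. f' b *\<^sub>R b)"
  have "f' u = u \<bullet> D" for u
  proof -
    have "f' u = f' (\<Sum>b\<in>Basis. (u \<bullet> b) *\<^sub>R b)" by (simp add: euclidean_representation)
    then show ?thesis
      by (simp add: sum scaleR D_def inner_sum_right mult.commute)
  qed
  then have D: "GDERIV f x :> D"
    using f' by (simp add: gderiv_def flip: \<open>\<And>u. f' u = u \<bullet> D\<close>)
  show ?thesis unfolding gradient_def
  proof (rule theI[of "\<lambda>D. GDERIV f x :> D", OF D])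
    fix D' assume "GDERIV f x :> D'"
    with D have "(\<lambda>u. u \<bullet> D') = (\<lambda>u. u \<bullet> D)"
      unfolding gderiv_def by (blast intro: has_derivative_unique)
    then have "(D' - D) \<bullet> D' = (D' - D) \<bullet> D" by (rule fun_cong)
    then have "(D' - D) \<bullet> (D' - D) = 0" by (simp add: inner_diff_right)
    then show "D' = D" by simp
  qed
qed

context
  fixes f :: "'a::euclidean_space \<Rightarrow> real" and L :: real
  assumes C2: "C2 f"
begin

lemma C2_has_derivative: "(f has_derivative (\<lambda>u. u \<bullet> gradient f x)) (at x within A)"
  using C2 gderiv_gradient[of f x] unfolding C2_def gderiv_def
  by (blast intro: has_derivative_at_withinI)

lemma C2_gradient_has_derivative: "(gradient f has_derivative hessian f x) (at x within A)"
proof -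
  have d: "(gradient f has_derivative frechet_derivative (gradient f) (at x)) (at x)"
    using C2 unfolding C2_def by (simp add: frechet_derivative_works)
  then have "bounded_linear (frechet_derivative (gradient f) (at x))"
    by (rule has_derivative_bounded_linear)
  then show ?thesis
    using d by (simp add: hessian_def bounded_linear_Blinfun_apply has_derivative_at_withinI)
qed

lemma C2_line_derivative:
  "((\<lambda>t. f (a + t *\<^sub>R d)) has_real_derivative gradient f (a + t *\<^sub>R d) \<bullet> d) (at t within A)"
proof -
  have "((\<lambda>t. f (a + t *\<^sub>R d)) has_derivative (\<lambda>s. (s *\<^sub>R d) \<bullet> gradient f (a + t *\<^sub>R d))) (at t within A)"
    by (rule has_derivative_compose[where g = f, OF _ C2_has_derivative]) (auto intro!: derivative_eq_intros)
  then show ?thesis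
    by (simp add: has_field_derivative_def inner_commute mult.commute[of _ "_ \<bullet> _"] fun_eq_iff)
qed

lemma C2_gradient_line_derivative:
  "((\<lambda>t. gradient f (a + t *\<^sub>R d) \<bullet> u) has_real_derivative
     hessian f (a + t *\<^sub>R d) d \<bullet> u) (at t within A)"
proof -
  have "((\<lambda>t. gradient f (a + t *\<^sub>R d)) has_derivative (\<lambda>s. hessian f (a + t *\<^sub>R d) (s *\<^sub>R d))) (at t within A)"
    by (rule has_derivative_compose[where g = "gradient f", OF _ C2_gradient_has_derivative])
      (auto intro!: derivative_eq_intros)
  then have "((\<lambda>t. gradient f (a + t *\<^sub>R d) \<bullet> u) has_derivative
      (\<lambda>s. hessian f (a + t *\<^sub>R d) (s *\<^sub>R d) \<bullet> u)) (at t within A)"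
    by (rule has_derivative_inner_left)
  then show ?thesis
    by (simp add: has_field_derivative_def blinfun.scaleR_right mult.commute[of _ "_ \<bullet> _"])
qed

lemma C2_continuous_gradient: "continuous_on A (gradient f)"
  by (rule has_derivative_continuous_on[OF C2_gradient_has_derivative])

lemma C2_continuous: "continuous_on A f"
  by (rule has_derivative_continuous_on[OF C2_has_derivative])

context
  assumes lipschitz: "L-lipschitz_on UNIV (hessian f)"
begin

lemma hessian_diff_bound:
  assumes "0 \<le> t"
  shows "(hessian f (a + t *\<^sub>R d) d - hessian f a d) \<bullet> u \<le> L * t * (norm d)\<^sup>2 * norm u"
proof -
  have "(hessian f (a + t *\<^sub>R d) d - hessian f a d) \<bullet> u
      \<le> norm ((hessian f (a + t *\<^sub>R d) - hessian f a) d) * norm u"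
    by (simp add: blinfun.diff_left norm_cauchy_schwarz)
  also have "\<dots> \<le> (norm (hessian f (a + t *\<^sub>R d) - hessian f a) * norm d) * norm u"
    by (intro mult_right_mono norm_blinfun) auto
  also have "\<dots> \<le> (L * norm (t *\<^sub>R d) * norm d) * norm u"
    using lipschitz_onD[OF lipschitz, of "a + t *\<^sub>R d" a]
    by (intro mult_right_mono) (auto simp: dist_norm)
  finally show ?thesis using assms by (simp add: power2_eq_square mult_ac)
qed

lemma gradient_taylor_inner_bound:
  assumes "0 \<le> t"
  shows "(gradient f (a + t *\<^sub>R d) - gradient f a - t *\<^sub>R hessian f a d) \<bullet> u
    \<le> L / 2 * t\<^sup>2 * (norm d)\<^sup>2 * norm u"
proof -
  define \<phi> where "\<phi> s = gradient f (a + s *\<^sub>R d) \<bullet> u - s * (hessian f a d \<bullet> u)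
    - L / 2 * s\<^sup>2 * (norm d)\<^sup>2 * norm u" for s
  have "(\<phi> has_real_derivative (hessian f (a + s *\<^sub>R d) d \<bullet> u - hessian f a d \<bullet> u
      - L * s * (norm d)\<^sup>2 * norm u)) (at s)" for s
    unfolding \<phi>_def
    by (rule derivative_eq_intros C2_gradient_line_derivative | simp)+
  moreover have "hessian f (a + s *\<^sub>R d) d \<bullet> u - hessian f a d \<bullet> u - L * s * (norm d)\<^sup>2 * norm u \<le> 0"
    if "0 \<le> s" for s
    using hessian_diff_bound[OF that, of a d u] by (simp add: inner_diff_left)
  ultimately have "\<phi> t \<le> \<phi> 0"
    by (intro DERIV_nonpos_imp_nonincreasing[OF assms]) blast
  then show ?thesis by (simp add: \<phi>_def inner_diff_left)
qed

lemma gradient_taylor_bound: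
  "norm (gradient f b - gradient f a - hessian f a (b - a)) \<le> L / 2 * (norm (b - a))\<^sup>2"
proof -
  \<comment> \<open>Testing against the remainder itself turns the scalar bound into a norm bound
    after one factor is cancelled.\<close>
  let ?u = "gradient f b - gradient f a - hessian f a (b - a)"
  have "(norm ?u)\<^sup>2 \<le> L / 2 * (norm (b - a))\<^sup>2 * norm ?u"
    using gradient_taylor_inner_bound[of 1 a "b - a" ?u] by (simp add: power2_norm_eq_inner)
  then have "norm ?u * norm ?u \<le> L / 2 * (norm (b - a))\<^sup>2 * norm ?u"
    by (simp add: power2_eq_square)
  then show ?thesis
    using lipschitz_on_nonneg[OF lipschitz] by (cases "norm ?u = 0") auto
qed

lemma taylor2_bound: "\<bar>f b - taylor2 a f b\<bar> \<le> L / 6 * (norm (b - a)) ^ 3"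
proof -
  define d where "d = b - a"
  define e where "e s = gradient f (a + s *\<^sub>R d) \<bullet> d - gradient f a \<bullet> d - s * (hessian f a d \<bullet> d)" for s
  have e: "\<bar>e s\<bar> \<le> L / 2 * s\<^sup>2 * (norm d) ^ 3" if "0 \<le> s" for s
    using gradient_taylor_inner_bound[OF that, of a d d] gradient_taylor_inner_bound[OF that, of a d "- d"]
    by (simp add: e_def inner_diff_left algebra_simps power2_eq_square power3_eq_cube abs_if)
  \<comment> \<open>The sign \<open>c\<close> covers the upper and the lower estimate at once;
    \<open>e\<close> is the derivative of the Taylor remainder along the segment.\<close>
  define \<phi> where "\<phi> c s = c * (f (a + s *\<^sub>R d) - s * (gradient f a \<bullet> d) - s\<^sup>2 / 2 * (hessian f a d \<bullet> d))
    - L / 6 * s ^ 3 * (norm d) ^ 3" for c s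
  have "\<phi> c 1 \<le> \<phi> c 0" if c: "\<bar>c\<bar> = 1" for c
  proof (rule DERIV_nonpos_imp_nonincreasing[where f = "\<phi> c"])
    fix s :: real assume s: "0 \<le> s" "s \<le> 1"
    have "(\<phi> c has_real_derivative (c * e s - L / 2 * s\<^sup>2 * (norm d) ^ 3)) (at s)"
      unfolding \<phi>_def e_def
      by (rule derivative_eq_intros C2_line_derivative refl | simp)+
    moreover have "c * e s - L / 2 * s\<^sup>2 * (norm d) ^ 3 \<le> 0"
    proof -
      have "c * e s \<le> \<bar>e s\<bar>"
        by (metis abs_ge_self abs_mult c mult_1)
      then show ?thesis using e[OF s(1)] by simp
    qed
    ultimately show "\<exists>y. (\<phi> c has_real_derivative y) (at s) \<and> y \<le> 0" by blast
  qed simp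
  from this[of 1] have "f b - taylor2 a f b \<le> L / 6 * (norm (b - a)) ^ 3"
    by (simp add: \<phi>_def d_def taylor2_def inner_commute)
  moreover from \<open>\<And>c. \<bar>c\<bar> = 1 \<Longrightarrow> \<phi> c 1 \<le> \<phi> c 0\<close>[of "-1"]
  have "- (f b - taylor2 a f b) \<le> L / 6 * (norm (b - a)) ^ 3"
    by (simp add: \<phi>_def d_def taylor2_def inner_commute)
  ultimately show ?thesis by (rule abs_leI)
qed

text \<open>The second difference is symmetric in \<open>u\<close> and \<open>v\<close>, and the error is of third order, so
  letting \<open>u\<close> and \<open>v\<close> shrink yields the symmetry of the Hessian.\<close>

lemma second_difference_bound:
  fixes a u v :: 'a
  defines "r \<equiv> norm u + norm v"
  shows "\<bar>f (a + u + v) - f (a + u) - f (a + v) + f a - hessian f a v \<bullet> u\<bar> \<le> L * r ^ 3"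
proof -
  define e where "e b = gradient f b - gradient f a - hessian f a (b - a)" for b
  have L: "0 \<le> L" using lipschitz by (rule lipschitz_on_nonneg)
  have r: "norm u \<le> r" "0 \<le> r" by (auto simp: r_def)
  have e: "\<bar>e b \<bullet> u\<bar> \<le> L / 2 * r ^ 3" if "norm (b - a) \<le> r" for b
  proof -
    have "\<bar>e b \<bullet> u\<bar> \<le> (L / 2 * (norm (b - a))\<^sup>2) * norm u"
      by (rule order_trans[OF Cauchy_Schwarz_ineq2], rule mult_right_mono)
        (simp_all only: e_def gradient_taylor_bound norm_ge_zero)
    also have "\<dots> \<le> (L / 2 * r\<^sup>2) * r"
      using L r that by (intro mult_mono power_mono mult_left_mono) auto
    finally show ?thesis by (simp add: power2_eq_square power3_eq_cube)
  qed
  \<comment> \<open>The increments along \<open>u\<close> from \<open>a + v\<close> and from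
    \<open>a\<close> are subtracted. One use of the mean value theorem leaves two gradient errors,
    both taken within distance \<open>r\<close> of \<open>a\<close>.\<close>
  define \<phi> where "\<phi> s = f ((a + v) + s *\<^sub>R u) - f (a + s *\<^sub>R u) - s * (hessian f a v \<bullet> u)" for s
  define \<psi> where "\<psi> s = gradient f ((a + v) + s *\<^sub>R u) \<bullet> u - gradient f (a + s *\<^sub>R u) \<bullet> u
      - hessian f a v \<bullet> u" for s
  have "(\<phi> has_real_derivative \<psi> s) (at s)" for s
    unfolding \<phi>_def \<psi>_def by (rule derivative_eq_intros C2_line_derivative refl | simp)+
  then obtain s where s: "0 < s" "s < 1" "\<phi> 1 - \<phi> 0 = \<psi> s"
    using MVT2[of 0 1 \<phi> \<psi>] by auto
  have "\<psi> s = e ((a + v) + s *\<^sub>R u) \<bullet> u - e (a + s *\<^sub>R u) \<bullet> u"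
    by (simp add: \<psi>_def e_def inner_diff_left blinfun.add_right inner_add_left algebra_simps)
  moreover have "\<bar>e ((a + v) + s *\<^sub>R u) \<bullet> u\<bar> \<le> L / 2 * r ^ 3"
  proof (rule e)
    have "norm (v + s *\<^sub>R u) \<le> norm v + norm (s *\<^sub>R u)" by (rule norm_triangle_ineq)
    also have "\<dots> \<le> r" using s by (simp add: r_def mult_left_le_one_le)
    finally show "norm (a + v + s *\<^sub>R u - a) \<le> r" by (simp add: add.assoc)
  qed
  moreover have "\<bar>e (a + s *\<^sub>R u) \<bullet> u\<bar> \<le> L / 2 * r ^ 3"
  proof (rule e)
    have "norm (s *\<^sub>R u) \<le> norm u" using s by (simp add: mult_left_le_one_le)
    then show "norm (a + s *\<^sub>R u - a) \<le> r" using r by simp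
  qed
  ultimately have "\<bar>\<phi> 1 - \<phi> 0\<bar> \<le> L * r ^ 3" using s(3) by linarith
  then show ?thesis by (simp add: \<phi>_def algebra_simps)
qed

lemma hessian_symmetric: "hessian f a u \<bullet> v = u \<bullet> hessian f a v"
proof -
  let ?B = "\<bar>hessian f a v \<bullet> u - hessian f a u \<bullet> v\<bar>"
  define C where "C = 2 * L * (norm u + norm v) ^ 3"
  have bound: "?B \<le> C * t" if t: "0 < t" for t :: real
  proof -
    define X where "X = f (a + t *\<^sub>R u + t *\<^sub>R v) - f (a + t *\<^sub>R u) - f (a + t *\<^sub>R v) + f a"
    have X': "X = f (a + t *\<^sub>R v + t *\<^sub>R u) - f (a + t *\<^sub>R v) - f (a + t *\<^sub>R u) + f a"
      by (simp add: X_def add_ac)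
    have r: "norm (t *\<^sub>R u) + norm (t *\<^sub>R v) = t * (norm u + norm v)"
      using t by (simp add: algebra_simps)
    have "\<bar>X - t\<^sup>2 * (hessian f a v \<bullet> u)\<bar> \<le> C / 2 * t ^ 3"
      using second_difference_bound[of a "t *\<^sub>R u" "t *\<^sub>R v"]
      unfolding r by (simp add: X_def C_def blinfun.scaleR_right power2_eq_square power_mult_distrib mult_ac)
    moreover have "\<bar>X - t\<^sup>2 * (hessian f a u \<bullet> v)\<bar> \<le> C / 2 * t ^ 3"
      using second_difference_bound[of a "t *\<^sub>R v" "t *\<^sub>R u"]
      unfolding r add.commute[of "norm (t *\<^sub>R v)"]
      by (simp add: X' C_def blinfun.scaleR_right power2_eq_square power_mult_distrib mult_ac)
    ultimately have "\<bar>t\<^sup>2 * (hessian f a v \<bullet> u) - t\<^sup>2 * (hessian f a u \<bullet> v)\<bar> \<le> C * t ^ 3"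
      by linarith
    moreover have "\<bar>t\<^sup>2 * (hessian f a v \<bullet> u) - t\<^sup>2 * (hessian f a u \<bullet> v)\<bar> = t\<^sup>2 * ?B"
      by (simp add: abs_mult flip: right_diff_distrib)
    ultimately have "t\<^sup>2 * ?B \<le> t\<^sup>2 * (C * t)" by (simp add: power2_eq_square power3_eq_cube mult_ac)
    then show ?thesis using t by simp
  qed
  have "?B \<le> 0"
  proof (rule tendsto_lowerbound)
    show "((\<lambda>t. C * t) \<longlongrightarrow> 0) (at_right 0)" by (auto intro!: tendsto_eq_intros)
    show "\<forall>\<^sub>F t in at_right 0. ?B \<le> C * t"
      using eventually_at_right_less[of 0] by eventually_elim (rule bound)
  qed simp
  then show ?thesis by (simp add: inner_commute)
qed

text \<open>Symmetry of the Hessian merges the two halves of the derivative of the quadratic term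
  into \<open>hessian f a (b - a)\<close>.\<close>

lemma taylor2_gderiv:
  "GDERIV (taylor2 a f) b :> gradient f a + hessian f a (b - a)"
proof -
  have "((\<lambda>x. f a + gradient f a \<bullet> (x - a) + (1/2) * ((x - a) \<bullet> blinfun_apply (hessian f a) (x - a)))
    has_derivative (\<lambda>u. gradient f a \<bullet> u + (1/2) * ((b - a) \<bullet> hessian f a u + u \<bullet> hessian f a (b - a)))) (at b)"
    by (auto intro!: derivative_eq_intros)
  moreover have "(b - a) \<bullet> hessian f a u = u \<bullet> hessian f a (b - a)" for u
    using hessian_symmetric[of a "b - a" u] by (simp add: inner_commute)
  ultimately show ?thesis
    by (simp add: gderiv_def taylor2_def[abs_def] inner_add_right inner_commute)
qed

end

section \<open>Convexity of the function and of its Taylor polynomial\<close>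

context
  assumes convex: "convex_on UNIV f"
begin

lemma gradient_inequality: "f a + gradient f a \<bullet> (b - a) \<le> f b"
proof -
  define \<phi> where "\<phi> t = f (a + t *\<^sub>R (b - a))" for t
  have cvx: "convex_on UNIV \<phi>"
  proof (rule convex_onI)
    fix s t u :: real assume s: "0 < s" "s < 1"
    have "a + ((1 - s) *\<^sub>R t + s *\<^sub>R u) *\<^sub>R (b - a)
        = (1 - s) *\<^sub>R (a + t *\<^sub>R (b - a)) + s *\<^sub>R (a + u *\<^sub>R (b - a))"
      by (simp add: algebra_simps)
    then show "\<phi> ((1 - s) *\<^sub>R t + s *\<^sub>R u) \<le> (1 - s) * \<phi> t + s * \<phi> u"
      using convex_onD[OF convex, of s] s by (simp add: \<phi>_def)
  qed simp
  have "\<phi> 1 - \<phi> 0 \<ge> (gradient f (a + 0 *\<^sub>R (b - a)) \<bullet> (b - a)) * (1 - 0)"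
    unfolding \<phi>_def
    by (rule convex_on_imp_above_tangent[OF cvx[unfolded \<phi>_def]])
      (use C2_line_derivative[of a "b - a" 0 UNIV] in auto)
  then show ?thesis by (simp add: \<phi>_def)
qed

text \<open>Two opposite gradient inequalities give monotonicity of the gradient along
  \<open>d\<close>. Its first-order expansion has an error of order \<open>t\<close> squared, so
  division by \<open>t\<close> and passage to the limit leave the quadratic form.\<close>

lemma hessian_psd:
  assumes lipschitz: "L-lipschitz_on UNIV (hessian f)"
  shows "0 \<le> d \<bullet> hessian f a d"
proof (rule tendsto_lowerbound)
  show "((\<lambda>t. d \<bullet> hessian f a d + L / 2 * t * (norm d) ^ 3) \<longlongrightarrow> d \<bullet> hessian f a d) (at_right 0)"
    by (auto intro!: tendsto_eq_intros)
  have "0 \<le> d \<bullet> hessian f a d + L / 2 * t * (norm d) ^ 3" if t: "0 < t" for t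
  proof -
    have "0 \<le> t * ((gradient f (a + t *\<^sub>R d) - gradient f a) \<bullet> d)"
      using gradient_inequality[of a "a + t *\<^sub>R d"] gradient_inequality[of "a + t *\<^sub>R d" a]
      by (simp add: inner_diff_left algebra_simps)
    then have "0 \<le> (gradient f (a + t *\<^sub>R d) - gradient f a) \<bullet> d" using t by (simp add: zero_le_mult_iff)
    also have "\<dots> \<le> t * (hessian f a d \<bullet> d) + L / 2 * t\<^sup>2 * (norm d) ^ 3"
      using gradient_taylor_inner_bound[OF lipschitz, of t a d d] t
      by (simp add: inner_diff_left power2_eq_square power3_eq_cube mult_ac)
    also have "\<dots> = t * (d \<bullet> hessian f a d + L / 2 * t * (norm d) ^ 3)"
      by (simp add: algebra_simps power2_eq_square inner_commute)
    finally show ?thesis using t by (simp add: zero_le_mult_iff)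
  qed
  then show "\<forall>\<^sub>F t in at_right 0. 0 \<le> d \<bullet> hessian f a d + L / 2 * t * (norm d) ^ 3"
    using eventually_at_right_less[of "0::real"] by (rule eventually_mono[rotated])
qed simp

text \<open>For a quadratic polynomial the gap in the gradient inequality is exactly half the
  Hessian form at \<open>b' - b\<close>. Convexity thus passes from the data to the model of the
  Newton step.\<close>

lemma taylor2_gradient_inequality:
  assumes lipschitz: "L-lipschitz_on UNIV (hessian f)"
  shows "taylor2 a f b + (gradient f a + hessian f a (b - a)) \<bullet> (b' - b) \<le> taylor2 a f b'"
proof -
  have "b' - a = (b - a) + (b' - b)" by simp
  then have "taylor2 a f b' = f a + gradient f a \<bullet> ((b - a) + (b' - b))
      + (1/2) * (((b - a) + (b' - b)) \<bullet> hessian f a ((b - a) + (b' - b)))"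
    by (simp only: taylor2_def)
  also have "\<dots> = taylor2 a f b + (gradient f a + hessian f a (b - a)) \<bullet> (b' - b)
      + (1/2) * ((b' - b) \<bullet> hessian f a (b' - b))"
    using hessian_symmetric[OF lipschitz, of a "b - a" "b' - b"]
    unfolding taylor2_def
    by (simp only: inner_add_left inner_add_right blinfun.add_right)
       (simp add: inner_commute algebra_simps)
  finally show ?thesis using hessian_psd[OF lipschitz, of "b' - b" a] by simp
qed

end

end

section \<open>Componentwise nonnegative vectors\<close>

lemma inner_nonneg_vec:
  fixes a b :: "real ^ 'm"
  assumes "0 \<le> a" "0 \<le> b"
  shows "0 \<le> a \<bullet> b"
  using assms by (auto simp: inner_vec_def less_eq_vec_def intro!: sum_nonneg)

lemma neg_part_nonneg: "0 \<le> neg_part v"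
  by (simp add: neg_part_def less_eq_vec_def)

lemma pos_part_nonneg: "0 \<le> v + neg_part v"
  by (simp add: neg_part_def less_eq_vec_def max_def)

lemma pos_part_inner_neg_part: "(v + neg_part v) \<bullet> neg_part v = 0"
  by (auto simp: neg_part_def inner_vec_def max_def intro!: sum.neutral)

lemma neg_part_scaleR: "0 \<le> c \<Longrightarrow> neg_part (c *\<^sub>R v) = c *\<^sub>R neg_part v"
  by (auto simp: neg_part_def vec_eq_iff max_def mult_le_0_iff zero_le_mult_iff)

text \<open>Used with \<open>u = Lg\<close>: it controls how the multiplier-dependent coefficient of
  \<open>quad\<close> changes when the multiplier moves.\<close>

lemma inner_le_norm_of_nonneg:
  fixes a b u :: "real ^ 'm"
  assumes "0 \<le> u"
  shows "u \<bullet> \<bar>a\<bar> \<le> u \<bullet> \<bar>b\<bar> + norm u * norm (a - b)"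
proof -
  have "u \<bullet> \<bar>a\<bar> \<le> u \<bullet> (\<bar>b\<bar> + \<bar>a - b\<bar>)"
    using assms by (auto simp: inner_vec_def less_eq_vec_def abs_vec_def intro!: sum_mono mult_left_mono)
  also have "\<dots> \<le> u \<bullet> \<bar>b\<bar> + norm u * norm \<bar>a - b\<bar>"
    by (simp add: inner_add_right norm_cauchy_schwarz)
  also have "norm \<bar>a - b\<bar> = norm (a - b)"
    by (simp add: norm_vec_def abs_vec_def)
  finally show ?thesis .
qed

section \<open>The Lagrangian\<close>

context convex_program
begin

lemma L0_nonneg: "0 \<le> L0"
  using f_hessian_lipschitz by (rule lipschitz_on_nonneg)

lemma Lg_nonneg: "0 \<le> Lg"
  using lipschitz_on_nonneg[OF g_hessian_lipschitz] by (simp add: less_eq_vec_def)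

lemma Lg_pos: "0 < norm Lg"
  using Lg_nonzero by (auto simp: vec_eq_iff)

text \<open>A real-valued stand-in that agrees with \<open>Lbar\<close> for nonnegative multipliers,
  so that extended reals enter only when certificates become subdifferentials.\<close>

definition lagrangian where "lagrangian x y = f x + y \<bullet> g x"

lemma grad_lagrangian_eq:
  "grad_lagrangian x y = gradient f x + (\<Sum>i\<in>UNIV. y $ i *\<^sub>R gradient (\<lambda>u. g u $ i) x)"
  by (simp add: grad_lagrangian_def grad_matrix_def matrix_vector_mult_def vec_eq_iff mult.commute)

lemma lagrangian_gradient_inequality:
  assumes "0 \<le> y"
  shows "lagrangian a y + grad_lagrangian a y \<bullet> (b - a) \<le> lagrangian b y"
proof -
  have "(\<Sum>i\<in>UNIV. y $ i * (g a $ i + gradient (\<lambda>u. g u $ i) a \<bullet> (b - a))) \<le> (\<Sum>i\<in>UNIV. y $ i * g b $ i)"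
    using assms by (intro sum_mono mult_left_mono gradient_inequality[OF g_C2 g_convex])
      (auto simp: less_eq_vec_def)
  then show ?thesis
    using gradient_inequality[OF f_C2 f_convex, of a b]
    by (simp add: lagrangian_def grad_lagrangian_eq inner_add_left inner_sum_left inner_vec_def[of y]
        distrib_left sum.distrib)
qed

text \<open>The primal part is the gradient inequality, the dual part is affine. With
  \<open>y \<bullet> w\<close> allowed as an error, the contribution of \<open>w\<close> collapses
  to \<open>- (w \<bullet> y')\<close>, which has the right sign. This is the reason for the form of
  \<open>eps k\<close>.\<close>

lemma lagrangian_saddle_inequality:
  assumes "0 \<le> y" "0 \<le> y'" "0 \<le> w"
  shows "(S (a, y) - (0, w)) \<bullet> ((b, y') - (a, y)) - y \<bullet> w \<le> lagrangian b y - lagrangian a y'"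
proof -
  have "(S (a, y) - (0, w)) \<bullet> ((b, y') - (a, y)) - y \<bullet> w
      = grad_lagrangian a y \<bullet> (b - a) - g a \<bullet> (y' - y) - w \<bullet> y'"
    by (simp add: S_def inner_diff_left inner_diff_right inner_commute)
  also have "\<dots> \<le> lagrangian b y - lagrangian a y - g a \<bullet> (y' - y)"
    using lagrangian_gradient_inequality[OF assms(1), of a b] inner_nonneg_vec[OF assms(3,2)] by simp
  finally show ?thesis by (simp add: lagrangian_def inner_diff_right inner_commute)
qed

text \<open>A KKT pair is a saddle point: \<open>lagrangian a' y\<close> is at most
  \<open>lagrangian a' y'\<close>, which is at most \<open>lagrangian a y'\<close>. The saddle
  inequality at that pair then bounds the inner product.\<close>

lemma residual_inner_KKT:
  assumes "(a', y') \<in> KKT" "0 \<le> y" "0 \<le> w"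
  shows "- (y \<bullet> w) \<le> (S (a, y) - (0, w)) \<bullet> ((a, y) - (a', y'))"
proof -
  have kkt: "grad_lagrangian a' y' = 0" "0 \<le> - g a'" "0 \<le> y'" "y' \<bullet> g a' = 0"
    using assms(1) by (auto simp: KKT_def)
  have "lagrangian a' y \<le> lagrangian a' y'"
    using inner_nonneg_vec[OF assms(2) kkt(2)] kkt(4) by (simp add: lagrangian_def)
  also have "\<dots> \<le> lagrangian a y'"
    using lagrangian_gradient_inequality[OF kkt(3), of a' a] kkt(1) by simp
  finally have "(S (a, y) - (0, w)) \<bullet> ((a', y') - (a, y)) \<le> y \<bullet> w"
    using lagrangian_saddle_inequality[OF assms(2) kkt(3) assms(3), of a a'] by simp
  then show ?thesis
    by (metis inner_minus_right minus_diff_eq neg_le_iff_le)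
qed

text \<open>Closedness makes the distance \<open>d0\<close> attained and, since the starting point
  is not a KKT pair, positive.\<close>

lemma KKT_closed: "closed KKT"
proof -
  have g: "continuous_on UNIV g"
    by (rule continuous_on_vec_lambda[where f = "\<lambda>i u. g u $ i", simplified])
      (rule C2_continuous[OF g_C2])
  have cg: "continuous_on UNIV (\<lambda>p. gradient F (fst p))" if "C2 F"
    for F :: "real ^ 'n \<Rightarrow> real"
    by (rule continuous_on_compose2[OF C2_continuous_gradient[OF that, of UNIV]])
      (auto intro!: continuous_intros)
  have g': "continuous_on UNIV (\<lambda>p. g (fst p))"
    by (rule continuous_on_compose2[OF g]) (auto intro!: continuous_intros)
  have "closed {p. gradient f (fst p) + (\<Sum>i\<in>UNIV. snd p $ i *\<^sub>R gradient (\<lambda>u. g u $ i) (fst p)) = 0}"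
    by (intro closed_Collect_eq continuous_intros cg f_C2 g_C2)
  moreover have "closed {p :: (real ^ 'n) \<times> (real ^ 'm). \<forall>i. g (fst p) $ i \<le> 0}"
    by (intro closed_Collect_all closed_Collect_le continuous_intros g')
  moreover have "closed {p :: (real ^ 'n) \<times> (real ^ 'm). \<forall>i. 0 \<le> snd p $ i}"
    by (intro closed_Collect_all closed_Collect_le continuous_intros)
  moreover have "closed {p. snd p \<bullet> g (fst p) = 0}"
    by (intro closed_Collect_eq continuous_intros g')
  moreover have "KKT = {p. gradient f (fst p) + (\<Sum>i\<in>UNIV. snd p $ i *\<^sub>R gradient (\<lambda>u. g u $ i) (fst p)) = 0}
     \<inter> {p. \<forall>i. g (fst p) $ i \<le> 0} \<inter> {p. \<forall>i. 0 \<le> snd p $ i} \<inter> {p. snd p \<bullet> g (fst p) = 0}"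
    by (auto simp: KKT_def grad_lagrangian_eq less_eq_vec_def)
  ultimately show ?thesis by (simp add: closed_Int)
qed

section \<open>The residual function\<close>

definition merit where
  "merit z0 \<mu> z w = (norm (\<mu> *\<^sub>R (S z - (0, w)) + z - z0))\<^sup>2 + 2 * \<mu> * (snd z \<bullet> w)"

text \<open>The minimizing \<open>w\<close> in the definition of \<Psi>, in closed form; for the
  iterates it is \<open>w k\<close>.\<close>

definition slack where
  "slack z0 \<mu> z = neg_part (g (fst z) + inverse \<mu> *\<^sub>R snd z0)"

lemma merit_nonneg: "0 < \<mu> \<Longrightarrow> 0 \<le> snd z \<Longrightarrow> 0 \<le> w \<Longrightarrow> 0 \<le> merit z0 \<mu> z w"
  by (simp add: merit_def inner_nonneg_vec)

lemma \<Psi>_le_merit: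
  assumes "0 < \<mu>" "0 \<le> snd z" "0 \<le> w"
  shows "\<Psi> z0 \<mu> z \<le> merit z0 \<mu> z w"
  unfolding \<Psi>_def merit_def[symmetric] using assms
  by (intro cINF_lower) (auto intro!: bdd_belowI2[of _ 0] merit_nonneg)

text \<open>\<open>P\<close> and \<open>\<mu> *\<^sub>R W\<close> are the positive and the negative
  part of \<open>\<mu> *\<^sub>R g a + y0\<close>, hence orthogonal. Expanding around
  \<open>W\<close>, the terms linear in \<open>y\<close> cancel and the excess is a square plus
  \<open>2 * \<mu> * (P \<bullet> w)\<close>, both nonnegative.\<close>

lemma merit_slack_le:
  assumes "0 < \<mu>" "0 \<le> w"
  shows "merit z0 \<mu> z (slack z0 \<mu> z) \<le> merit z0 \<mu> z w"
proof -
  obtain a y x0 y0 where z: "z = (a, y)" "z0 = (x0, y0)" by (metis surj_pair)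
  define W where "W = slack z0 \<mu> z"
  define P where "P = \<mu> *\<^sub>R (g a + inverse \<mu> *\<^sub>R y0 + W)"
  have "0 \<le> g a + inverse \<mu> *\<^sub>R y0 + W"
    unfolding W_def slack_def z by (simp add: pos_part_nonneg)
  then have P: "0 \<le> P" using assms(1) by (simp add: P_def less_eq_vec_def)
  have PW: "P \<bullet> W = 0"
    using pos_part_inner_neg_part[of "g a + inverse \<mu> *\<^sub>R y0"] by (simp add: P_def W_def slack_def z)
  have gP: "\<mu> *\<^sub>R g a + y0 = P - \<mu> *\<^sub>R W"
    using assms(1) by (simp add: P_def algebra_simps)
  have merit: "merit z0 \<mu> z u = (norm (\<mu> *\<^sub>R grad_lagrangian a y + a - x0))\<^sup>2
      + (norm (y - P + \<mu> *\<^sub>R (W - u)))\<^sup>2 + 2 * \<mu> * (y \<bullet> u)" for u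
  proof -
    have "\<mu> *\<^sub>R (- g a - u) + y - y0 = y - (\<mu> *\<^sub>R g a + y0) - \<mu> *\<^sub>R u" by (simp add: algebra_simps)
    also have "\<dots> = y - P + \<mu> *\<^sub>R (W - u)" unfolding gP by (simp add: algebra_simps)
    finally have snd_eq: "\<mu> *\<^sub>R (- g a - u) + y - y0 = y - P + \<mu> *\<^sub>R (W - u)" .
    have "\<mu> *\<^sub>R (S z - (0, u)) + z - z0
        = (\<mu> *\<^sub>R grad_lagrangian a y + a - x0, y - P + \<mu> *\<^sub>R (W - u))"
      unfolding snd_eq[symmetric] by (simp add: z S_def)
    then show ?thesis by (simp add: merit_def norm_Pair z)
  qed
  have "(norm (y - P + \<mu> *\<^sub>R (W - w)))\<^sup>2
      = (norm (y - P))\<^sup>2 + 2 * \<mu> * ((y - P) \<bullet> (W - w)) + \<mu>\<^sup>2 * (norm (W - w))\<^sup>2"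
    unfolding power2_norm_eq_inner
    by (simp add: inner_add_left inner_add_right inner_commute power2_eq_square algebra_simps)
  also have "2 * \<mu> * ((y - P) \<bullet> (W - w)) = 2 * \<mu> * (y \<bullet> W) - 2 * \<mu> * (y \<bullet> w) + 2 * \<mu> * (P \<bullet> w)"
    by (simp add: inner_diff_left inner_diff_right PW algebra_simps)
  finally have "merit z0 \<mu> z w = merit z0 \<mu> z W + \<mu>\<^sup>2 * (norm (W - w))\<^sup>2 + 2 * \<mu> * (P \<bullet> w)"
    by (simp add: merit)
  then show ?thesis
    using assms inner_nonneg_vec[OF P assms(2)] by (simp add: W_def)
qed

lemma \<Psi>_eq_merit_slack:
  assumes "0 < \<mu>"
  shows "\<Psi> z0 \<mu> z = merit z0 \<mu> z (slack z0 \<mu> z)"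
  unfolding \<Psi>_def merit_def[symmetric]
  by (rule cInf_eq_minimum) (auto simp: slack_def neg_part_nonneg intro: merit_slack_le[OF assms, unfolded slack_def])

lemma \<Psi>_nonneg: "0 < \<mu> \<Longrightarrow> 0 \<le> snd z \<Longrightarrow> 0 \<le> \<Psi> z0 \<mu> z"
  by (simp add: \<Psi>_eq_merit_slack merit_nonneg slack_def neg_part_nonneg)

section \<open>The function \<open>quad\<close> and its largest root\<close>

lemma quad_mono:
  assumes "0 \<le> r" "r \<le> r'"
  shows "quad y r \<le> quad y r'"
proof -
  have "0 \<le> L0 + Lg \<bullet> \<bar>y\<bar>"
    using L0_nonneg inner_nonneg_vec[OF Lg_nonneg, of "\<bar>y\<bar>"] by simp
  then show ?thesis
    unfolding quad_def using assms by (intro mult_mono add_left_mono mult_left_mono) auto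
qed

lemma quad_strict_mono:
  assumes "0 \<le> r" "r < r'"
  shows "quad y r < quad y r'"
proof -
  have "0 \<le> L0 + Lg \<bullet> \<bar>y\<bar>"
    using L0_nonneg inner_nonneg_vec[OF Lg_nonneg, of "\<bar>y\<bar>"] by simp
  then show ?thesis
    unfolding quad_def using assms Lg_pos
    by (intro mult_strict_mono add_strict_left_mono mult_strict_left_mono add_nonneg_pos) auto
qed

lemma quad_scale_le:
  assumes "1 \<le> b" "0 \<le> r"
  shows "quad y (b * r) \<le> b\<^sup>2 * quad y r"
proof -
  have "0 \<le> L0 + Lg \<bullet> \<bar>y\<bar>"
    using L0_nonneg inner_nonneg_vec[OF Lg_nonneg, of "\<bar>y\<bar>"] by simp
  then have "b * ((L0 + Lg \<bullet> \<bar>y\<bar>) / 2 * r) \<le> b\<^sup>2 * ((L0 + Lg \<bullet> \<bar>y\<bar>) / 2 * r)"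
    using assms by (intro mult_right_mono) (auto simp: power2_eq_square)
  then show ?thesis by (simp add: quad_def algebra_simps power2_eq_square)
qed

text \<open>The positive root of the quadratic equation with the radical moved to the denominator.
  For \<open>b = L0\<close> and \<alpha> = \<open>\<theta>\<^sup>2 / lam 1\<close> it is the
  constant \<open>\<rho>bar\<close> of the theorem.\<close>

definition quad_root where
  "quad_root b \<alpha> = 2 * \<alpha> / (b / 2 + sqrt ((b / 2)\<^sup>2 + 8 * norm Lg * \<alpha> / 3))"

lemma quad_root:
  assumes "0 \<le> b" "0 < \<alpha>"
  shows "0 < quad_root b \<alpha>"
    and "(b / 2 + 2 * norm Lg / 3 * quad_root b \<alpha>) * quad_root b \<alpha> = \<alpha>"
proof -
  define s where "s = sqrt ((b / 2)\<^sup>2 + 8 * norm Lg * \<alpha> / 3)"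
  have pos: "0 < (b / 2)\<^sup>2 + 8 * norm Lg * \<alpha> / 3"
    using assms Lg_pos by (intro add_nonneg_pos) auto
  then have s: "0 < s" "s\<^sup>2 = (b / 2)\<^sup>2 + 8 * norm Lg * \<alpha> / 3"
    by (auto simp: s_def)
  define t where "t = b / 2 + s"
  have t: "0 < t" using s assms by (simp add: t_def)
  have root: "quad_root b \<alpha> = 2 * \<alpha> / t" by (simp add: quad_root_def s_def t_def)
  then show "0 < quad_root b \<alpha>" using t assms by simp
  have "t\<^sup>2 = b * t + 8 * norm Lg * \<alpha> / 3"
    using s(2) by (simp add: t_def power2_eq_square algebra_simps)
  then have "\<alpha> * (b * t + 8 * norm Lg * \<alpha> / 3) / t\<^sup>2 = \<alpha> * t\<^sup>2 / t\<^sup>2"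
    by (simp only:)
  then have "\<alpha> = \<alpha> * (b * t + 8 * norm Lg * \<alpha> / 3) / t\<^sup>2"
    using t by simp
  also have "\<dots> = (b / 2 + 2 * norm Lg / 3 * quad_root b \<alpha>) * quad_root b \<alpha>"
    using t unfolding root by (simp add: field_simps power2_eq_square)
  finally show "(b / 2 + 2 * norm Lg / 3 * quad_root b \<alpha>) * quad_root b \<alpha> = \<alpha>" ..
qed

text \<open>Strict monotonicity of \<open>quad y\<close> on the nonnegative reals excludes roots
  beyond the positive one, so \<open>GREATEST\<close> denotes it.\<close>

lemma \<rho>_props:
  assumes "0 < \<alpha>"
  shows "0 < \<rho> y \<alpha>" "quad y (\<rho> y \<alpha>) = \<alpha>"
proof -
  define R where "R = quad_root (L0 + Lg \<bullet> \<bar>y\<bar>) \<alpha>"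
  have "0 \<le> L0 + Lg \<bullet> \<bar>y\<bar>"
    using L0_nonneg inner_nonneg_vec[OF Lg_nonneg, of "\<bar>y\<bar>"] by simp
  then have R: "0 < R" "quad y R = \<alpha>"
    using quad_root[OF _ assms] by (auto simp: R_def quad_def)
  have "\<rho> y \<alpha> = R" unfolding \<rho>_def
  proof (rule Greatest_equality)
    fix r assume "quad y r = \<alpha>"
    then show "r \<le> R" using quad_strict_mono[of R r y] R by force
  qed (rule R)
  then show "0 < \<rho> y \<alpha>" "quad y (\<rho> y \<alpha>) = \<alpha>" using R by auto
qed

lemma le_\<rho>: "0 < \<alpha> \<Longrightarrow> quad y r \<le> \<alpha> \<Longrightarrow> r \<le> \<rho> y \<alpha>"
  using quad_strict_mono[of "\<rho> y \<alpha>" r y] \<rho>_props[of \<alpha> y] by force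

text \<open>Dropping the multiplier lowers \<open>quad\<close>, and raising the right-hand side
  raises the root. This yields one radius valid for all iterates whose stepsize is at least
  \<open>lam 1\<close>.\<close>

lemma \<rho>_le_quad_root:
  assumes "0 < \<alpha>" "\<alpha> \<le> \<beta>"
  shows "\<rho> y \<alpha> \<le> quad_root L0 \<beta>"
proof (rule ccontr)
  assume *: "\<not> ?thesis"
  have q: "0 < quad_root L0 \<beta>" "quad 0 (quad_root L0 \<beta>) = \<beta>"
    using quad_root[of L0 \<beta>] assms L0_nonneg by (auto simp: quad_def)
  have "\<beta> < quad 0 (\<rho> y \<alpha>)"
    using quad_strict_mono[of "quad_root L0 \<beta>" "\<rho> y \<alpha>" 0] q * by simp
  also have "\<dots> \<le> quad y (\<rho> y \<alpha>)"
    unfolding quad_def using \<rho>_props(1)[OF assms(1), of y] inner_nonneg_vec[OF Lg_nonneg, of "\<bar>y\<bar>"]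
    by (intro mult_right_mono) auto
  finally show False using \<rho>_props(2)[OF assms(1)] assms(2) by simp
qed

end

section \<open>The Newton step\<close>

context convex_program
begin

definition model_gradient where
  "model_gradient a b y = gradient f a + hessian f a (b - a)
     + (\<Sum>i\<in>UNIV. y $ i *\<^sub>R (gradient (\<lambda>u. g u $ i) a + hessian (\<lambda>u. g u $ i) a (b - a)))"

definition model_lagrangian where
  "model_lagrangian a b y = taylor2 a f b + y \<bullet> taylor2_vec a g b"

lemma model_gradient_center: "model_gradient a a y = grad_lagrangian a y"
  by (simp add: model_gradient_def grad_lagrangian_eq)

lemma taylor2_vec_center: "taylor2_vec a g a = g a"
  by (simp add: taylor2_vec_def taylor2_def vec_eq_iff)

lemma model_gradient_inequality:
  assumes "0 \<le> y"
  shows "model_lagrangian a b y + model_gradient a b y \<bullet> (b' - b) \<le> model_lagrangian a b' y"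
proof -
  have "(\<Sum>i\<in>UNIV. y $ i * (taylor2 a (\<lambda>u. g u $ i) b
        + (gradient (\<lambda>u. g u $ i) a + hessian (\<lambda>u. g u $ i) a (b - a)) \<bullet> (b' - b)))
      \<le> (\<Sum>i\<in>UNIV. y $ i * taylor2 a (\<lambda>u. g u $ i) b')"
    using assms
    by (intro sum_mono mult_left_mono taylor2_gradient_inequality[OF g_C2 g_convex g_hessian_lipschitz])
      (auto simp: less_eq_vec_def)
  then show ?thesis
    using taylor2_gradient_inequality[OF f_C2 f_convex f_hessian_lipschitz, of a b b']
    by (simp add: model_lagrangian_def model_gradient_def inner_add_left inner_sum_left inner_vec_def[of y]
        taylor2_vec_def distrib_left sum.distrib)
qed

text \<open>The gradient inequalities at the two points are added; the model is affine in the
  multiplier, so the remaining function values combine into the constraint term.\<close>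

lemma model_monotone:
  assumes "0 \<le> y" "0 \<le> y'"
  shows "0 \<le> (model_gradient a b y - model_gradient a b' y') \<bullet> (b - b')
    - (taylor2_vec a g b - taylor2_vec a g b') \<bullet> (y - y')"
  using model_gradient_inequality[OF assms(1), of a b b'] model_gradient_inequality[OF assms(2), of a b' b]
  by (simp add: model_lagrangian_def inner_diff_left inner_diff_right inner_commute)

lemma model_gradient_error:
  "norm (grad_lagrangian b y - model_gradient a b y) \<le> (L0 + Lg \<bullet> \<bar>y\<bar>) / 2 * (norm (b - a))\<^sup>2"
proof -
  define e where "e F = gradient F b - gradient F a - hessian F a (b - a)" for F :: "real ^ 'n \<Rightarrow> real"
  let ?r = "(norm (b - a))\<^sup>2"
  have "grad_lagrangian b y - model_gradient a b y = e f + (\<Sum>i\<in>UNIV. y $ i *\<^sub>R e (\<lambda>u. g u $ i))"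
    by (simp add: grad_lagrangian_eq model_gradient_def e_def scaleR_diff_right scaleR_add_right
        sum.distrib sum_subtractf)
  also have "norm \<dots> \<le> norm (e f) + (\<Sum>i\<in>UNIV. norm (y $ i *\<^sub>R e (\<lambda>u. g u $ i)))"
    by (intro order_trans[OF norm_triangle_ineq] add_left_mono norm_sum)
  also have "\<dots> \<le> L0 / 2 * ?r + (\<Sum>i\<in>UNIV. \<bar>y $ i\<bar> * (Lg $ i / 2 * ?r))"
    unfolding norm_scaleR real_norm_def e_def
    by (intro add_mono sum_mono mult_left_mono abs_ge_zero gradient_taylor_bound f_C2 g_C2
        f_hessian_lipschitz g_hessian_lipschitz)
  also have "(\<Sum>i\<in>UNIV. \<bar>y $ i\<bar> * (Lg $ i / 2 * ?r)) = (Lg \<bullet> \<bar>y\<bar>) / 2 * ?r"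
    by (simp add: inner_vec_def abs_vec_def sum_distrib_left sum_distrib_right sum_divide_distrib mult_ac)
  finally show ?thesis by (simp add: add_divide_distrib distrib_right)
qed

lemma taylor2_vec_error: "norm (g b - taylor2_vec a g b) \<le> norm Lg / 6 * norm (b - a) ^ 3"
proof -
  \<comment> \<open>Comparing componentwise with a multiple of the vector \<open>Lg\<close> yields
    its Euclidean norm in the bound.\<close>
  have "norm (g b - taylor2_vec a g b) \<le> norm ((norm (b - a) ^ 3 / 6) *\<^sub>R Lg)"
  proof (rule norm_le_componentwise_cart)
    fix i
    have "norm ((g b - taylor2_vec a g b) $ i) \<le> Lg $ i / 6 * norm (b - a) ^ 3"
      using taylor2_bound[OF g_C2 g_hessian_lipschitz, of b i a] by (simp add: taylor2_vec_def)
    also have "\<dots> \<le> norm (((norm (b - a) ^ 3 / 6) *\<^sub>R Lg) $ i)"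
      using Lg_nonneg by (simp add: less_eq_vec_def)
    finally show "norm ((g b - taylor2_vec a g b) $ i) \<le> norm (((norm (b - a) ^ 3 / 6) *\<^sub>R Lg) $ i)" .
  qed
  then show ?thesis by (simp add: mult.commute)
qed

text \<open>The inner maximum over \<open>y' \<ge> 0\<close> is majorized, with equality at the solution, by a smooth
  function of \<open>x'\<close> (the distance of a vector to the nonpositive orthant is at most its distance to
  a fixed point of it), so the nonsmooth outer minimization still yields a stationarity equation.\<close>

lemma minimax_solution_optimality:
  assumes \<mu>: "0 < \<mu>"
    and sol: "minimax_solution {u. 0 \<le> u}
      (\<lambda>x' y'. taylor2 a f x' + y' \<bullet> taylor2_vec a g x'
         + ((norm (x' - x0))\<^sup>2 - (norm (y' - y0))\<^sup>2) / (2 * \<mu>)) (b, y)"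
  shows "y = (\<mu> *\<^sub>R taylor2_vec a g b + y0) + neg_part (\<mu> *\<^sub>R taylor2_vec a g b + y0)"
    and "\<mu> *\<^sub>R model_gradient a b y + b - x0 = 0"
proof -
  define q where "q = taylor2_vec a g"
  define F where "F x' y' = taylor2 a f x' + y' \<bullet> q x'
         + ((norm (x' - x0))\<^sup>2 - (norm (y' - y0))\<^sup>2) / (2 * \<mu>)" for x' y'
  define W where "W = neg_part (\<mu> *\<^sub>R q b + y0)"
  define P where "P = (\<mu> *\<^sub>R q b + y0) + W"
  have W: "0 \<le> W" and P: "0 \<le> P" and PW: "P \<bullet> W = 0"
    by (simp_all add: W_def P_def neg_part_nonneg pos_part_nonneg pos_part_inner_neg_part)
  \<comment> \<open>\<open>\<mu> *\<^sub>R (q x' - q b) + P\<close> equals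
    \<open>\<mu> *\<^sub>R q x' + y0 + W\<close>, so its norm is the distance from
    \<open>\<mu> *\<^sub>R q x' + y0\<close> to the point \<open>- W\<close> of the nonpositive
    orthant, kept fixed as \<open>x'\<close> varies.\<close>
  define U where "U x' = taylor2 a f x'
      + ((norm (x' - x0))\<^sup>2 + (norm (\<mu> *\<^sub>R (q x' - q b) + P))\<^sup>2 - (norm y0)\<^sup>2) / (2 * \<mu>)" for x'
  have F_eq: "F x' y' = U x' - ((norm (\<mu> *\<^sub>R (q x' - q b) + P - y'))\<^sup>2 + 2 * (y' \<bullet> W)) / (2 * \<mu>)"
    for x' y'
  proof -
    define B where "B = \<mu> *\<^sub>R (q x' - q b) + P"
    have Bq: "\<mu> *\<^sub>R q x' = B - W - y0" by (simp add: B_def P_def scaleR_diff_right)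
    have "2 * \<mu> * (y' \<bullet> q x') = 2 * (y' \<bullet> (\<mu> *\<^sub>R q x'))" by simp
    also have "\<dots> = 2 * (y' \<bullet> B) - 2 * (y' \<bullet> W) - 2 * (y' \<bullet> y0)"
      unfolding Bq by (simp add: inner_diff_right)
    also have "\<dots> = (norm B)\<^sup>2 - (norm y0)\<^sup>2 + (norm (y' - y0))\<^sup>2 - (norm (B - y'))\<^sup>2 - 2 * (y' \<bullet> W)"
      by (simp add: power2_norm_eq_inner inner_diff_left inner_diff_right inner_commute)
    finally have "y' \<bullet> q x' = ((norm B)\<^sup>2 - (norm y0)\<^sup>2 + (norm (y' - y0))\<^sup>2 - (norm (B - y'))\<^sup>2 - 2 * (y' \<bullet> W)) / (2 * \<mu>)"
      using \<mu> by (simp add: field_simps)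
    then show ?thesis
      unfolding F_def U_def B_def[symmetric] by (simp add: diff_divide_distrib add_divide_distrib)
  qed
  have F_le: "F x' y' \<le> U x'" if "0 \<le> y'" for x' y'
    unfolding F_eq using \<mu> inner_nonneg_vec[OF that W] by simp
  have arg_min: "(SUP y'\<in>{u. 0 \<le> u}. F b y') \<le> (SUP y'\<in>{u. 0 \<le> u}. F x' y')" for x'
    using sol by (simp add: minimax_solution_def is_arg_min_def F_def q_def not_less)
  have y: "0 \<le> y" and arg_max: "F b y' \<le> F b y" if "0 \<le> y'" for y'
    using sol that by (auto simp: minimax_solution_def is_arg_max_def F_def q_def not_less)
  have "F b P = U b" by (simp add: F_eq PW)
  then have "U b \<le> F b y" using arg_max[OF P] by simp
  then have "(norm (P - y))\<^sup>2 + 2 * (y \<bullet> W) \<le> 0"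
    using \<mu> unfolding F_eq by (simp add: divide_le_0_iff)
  then have "(norm (P - y))\<^sup>2 \<le> 0" using inner_nonneg_vec[OF y[OF P] W] by linarith
  then have "P = y" by simp
  then show "y = (\<mu> *\<^sub>R taylor2_vec a g b + y0) + neg_part (\<mu> *\<^sub>R taylor2_vec a g b + y0)"
    by (simp add: P_def W_def q_def)
  \<comment> \<open>The inner suprema at \<open>b\<close> and \<open>x'\<close> are sandwiched
    between \<open>U b\<close> and \<open>U x'\<close>. The majorant also keeps the sets bounded,
    without which \<open>SUP\<close> would say nothing.\<close>
  have U_min: "U b \<le> U x'" for x'
  proof -
    have "U b = F b P" by (simp add: F_eq PW)
    also have "\<dots> \<le> (SUP y'\<in>{u. 0 \<le> u}. F b y')"
      using P F_le by (intro cSUP_upper) (auto intro!: bdd_aboveI2)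
    also have "\<dots> \<le> (SUP y'\<in>{u. 0 \<le> u}. F x' y')" by (rule arg_min)
    also have "\<dots> \<le> U x'" using P F_le by (intro cSUP_least) auto
    finally show ?thesis .
  qed
  have norm_P: "(norm (\<mu> *\<^sub>R (q x' - q b) + P))\<^sup>2
      = (\<Sum>i\<in>UNIV. (\<mu> * (taylor2 a (\<lambda>u. g u $ i) x' - q b $ i) + P $ i)\<^sup>2)" for x'
    unfolding power2_norm_eq_inner inner_vec_def
    by (simp add: q_def taylor2_vec_def power2_eq_square)
  define G where "G i = gradient (\<lambda>u. g u $ i) a + hessian (\<lambda>u. g u $ i) a (b - a)" for i
  have dq: "(taylor2 a (\<lambda>u. g u $ i) has_derivative (\<lambda>u. u \<bullet> G i)) (at b)" for i
    using taylor2_gderiv[OF g_C2 g_hessian_lipschitz, of a i b] by (simp add: gderiv_def G_def)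
  have df: "(taylor2 a f has_derivative (\<lambda>u. u \<bullet> (gradient f a + hessian f a (b - a)))) (at b)"
    using taylor2_gderiv[OF f_C2 f_hessian_lipschitz, of a b] by (simp add: gderiv_def)
  have qb: "taylor2 a (\<lambda>u. g u $ i) b - q b $ i = 0" for i by (simp add: q_def taylor2_vec_def)
  have "(U has_derivative (\<lambda>u. u \<bullet> (gradient f a + hessian f a (b - a))
      + (2 * (u \<bullet> (b - x0)) + (\<Sum>i\<in>UNIV. 2 * P $ i * (\<mu> * (u \<bullet> G i)))) / (2 * \<mu>))) (at b)"
    unfolding U_def norm_P unfolding power2_norm_eq_inner divide_inverse
    by (rule derivative_eq_intros df dq refl)+ (simp add: qb inner_commute fun_eq_iff mult_ac)
  then have "(\<lambda>u. u \<bullet> (gradient f a + hessian f a (b - a))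
      + (2 * (u \<bullet> (b - x0)) + (\<Sum>i\<in>UNIV. 2 * P $ i * (\<mu> * (u \<bullet> G i)))) / (2 * \<mu>)) = (\<lambda>u. 0)"
    by (rule has_derivative_local_min) (simp add: U_min)
  then have stationary: "u \<bullet> (gradient f a + hessian f a (b - a))
      + (2 * (u \<bullet> (b - x0)) + (\<Sum>i\<in>UNIV. 2 * P $ i * (\<mu> * (u \<bullet> G i)))) / (2 * \<mu>) = 0" for u
    by (rule fun_cong)
  have "(\<Sum>i\<in>UNIV. 2 * P $ i * (\<mu> * (u \<bullet> G i))) = 2 * \<mu> * (u \<bullet> (\<Sum>i\<in>UNIV. P $ i *\<^sub>R G i))" for u
    by (simp add: inner_sum_right sum_distrib_left mult_ac)
  then have "u \<bullet> (\<mu> *\<^sub>R model_gradient a b y + b - x0) = 0" for u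
    using \<mu> \<open>P = y\<close> stationary[of u] unfolding model_gradient_def G_def[symmetric]
    by (simp add: inner_add_right inner_diff_right field_simps)
  then show "\<mu> *\<^sub>R model_gradient a b y + b - x0 = 0"
    by (meson inner_eq_zero_iff)
qed

text \<open>This is the strong monotonicity of the regularized model operator, applied to the exact zero
  \<open>(b, yb)\<close> and to \<open>(a, y)\<close>, at which \<open>-slack\<close> is only an approximate normal vector.\<close>

lemma newton_displacement:
  assumes \<mu>: "0 < \<mu>" and y: "0 \<le> y"
    and sol: "minimax_solution {u. 0 \<le> u}
      (\<lambda>x' y'. taylor2 a f x' + y' \<bullet> taylor2_vec a g x'
         + ((norm (x' - x0))\<^sup>2 - (norm (y' - y0))\<^sup>2) / (2 * \<mu>)) (b, yb)"
  shows "(norm ((b, yb) - (a, y)))\<^sup>2 \<le> \<Psi> (x0, y0) \<mu> (a, y)"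
proof -
  define W where "W = slack (x0, y0) \<mu> (a, y)"
  define W' where "W' = neg_part (\<mu> *\<^sub>R taylor2_vec a g b + y0)"
  define r1 where "r1 = \<mu> *\<^sub>R grad_lagrangian a y + a - x0"
  define r2 where "r2 = \<mu> *\<^sub>R (- g a - W) + y - y0"
  have yb: "yb = \<mu> *\<^sub>R taylor2_vec a g b + y0 + W'"
    using minimax_solution_optimality(1)[OF \<mu> sol] by (simp add: W'_def)
  then have yb0: "0 \<le> yb" "yb \<bullet> W' = 0"
    by (simp_all only: W'_def pos_part_nonneg pos_part_inner_neg_part)
  have W: "0 \<le> W" "0 \<le> W'" by (simp_all add: W_def W'_def slack_def neg_part_nonneg)
  have r1: "r1 = \<mu> *\<^sub>R (model_gradient a a y - model_gradient a b yb) + (a - b)"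
    using minimax_solution_optimality(2)[OF \<mu> sol]
    by (simp add: r1_def model_gradient_center scaleR_diff_right algebra_simps)
  have r2: "r2 = (y - yb) - \<mu> *\<^sub>R (taylor2_vec a g a - taylor2_vec a g b) - \<mu> *\<^sub>R W + W'"
    unfolding r2_def taylor2_vec_center by (subst yb) (simp add: algebra_simps)
  have "r1 \<bullet> (a - b) + r2 \<bullet> (y - yb) = (norm (a - b))\<^sup>2 + (norm (y - yb))\<^sup>2
      + \<mu> * ((model_gradient a a y - model_gradient a b yb) \<bullet> (a - b)
          - (taylor2_vec a g a - taylor2_vec a g b) \<bullet> (y - yb))
      - \<mu> * (W \<bullet> y) + \<mu> * (W \<bullet> yb) + W' \<bullet> y"
    using yb0(2) unfolding r1 r2 power2_norm_eq_inner
    by (simp add: inner_add_left inner_diff_left inner_diff_right inner_commute algebra_simps)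
  also have "\<dots> \<ge> (norm (a - b))\<^sup>2 + (norm (y - yb))\<^sup>2 - \<mu> * (W \<bullet> y)"
    using mult_nonneg_nonneg[OF less_imp_le[OF \<mu>] model_monotone[OF y yb0(1), of a a b]]
      mult_nonneg_nonneg[OF less_imp_le[OF \<mu>] inner_nonneg_vec[OF W(1) yb0(1)]] inner_nonneg_vec[OF W(2) y]
    by linarith
  finally have inner: "(norm (a - b))\<^sup>2 + (norm (y - yb))\<^sup>2 - \<mu> * (W \<bullet> y) \<le> r1 \<bullet> (a - b) + r2 \<bullet> (y - yb)" .
  \<comment> \<open>Expanding this square loses no constant: what remains on the right is the
    squared residual plus \<open>2 * \<mu> * (W \<bullet> y)\<close>, which is \<Psi>
    itself.\<close>
  have "0 \<le> (norm (r1 - (a - b)))\<^sup>2 + (norm (r2 - (y - yb)))\<^sup>2" by simp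
  also have "\<dots> = (norm r1)\<^sup>2 + (norm r2)\<^sup>2 + (norm (a - b))\<^sup>2 + (norm (y - yb))\<^sup>2
      - 2 * (r1 \<bullet> (a - b) + r2 \<bullet> (y - yb))"
    unfolding power2_norm_eq_inner
    by (simp add: inner_diff_left inner_diff_right inner_commute)
  finally have "(norm (a - b))\<^sup>2 + (norm (y - yb))\<^sup>2 \<le> (norm r1)\<^sup>2 + (norm r2)\<^sup>2 + 2 * \<mu> * (W \<bullet> y)"
    using inner by (simp add: algebra_simps)
  also have "\<dots> = \<Psi> (x0, y0) \<mu> (a, y)"
    by (simp add: \<Psi>_eq_merit_slack[OF \<mu>] merit_def W_def[symmetric] S_def norm_Pair r1_def r2_def inner_commute)
  finally show ?thesis by (simp add: norm_Pair norm_minus_commute)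
qed

text \<open>With the rescaled slack of the subproblem as \<open>w\<close>, optimality cancels the
  model from the residual and leaves only Taylor errors, while \<open>yb \<bullet> W = 0\<close>
  removes the extra term of the merit.\<close>

lemma newton_residual:
  assumes \<mu>: "0 < \<mu>"
    and sol: "minimax_solution {u. 0 \<le> u}
      (\<lambda>x' y'. taylor2 a f x' + y' \<bullet> taylor2_vec a g x'
         + ((norm (x' - x0))\<^sup>2 - (norm (y' - y0))\<^sup>2) / (2 * \<mu>)) (b, yb)"
  shows "sqrt (\<Psi> (x0, y0) \<mu> (b, yb))
    \<le> \<mu> * (((L0 + Lg \<bullet> \<bar>yb\<bar>) / 2 + norm Lg / 6 * norm (b - a)) * (norm (b - a))\<^sup>2)"
    and "0 \<le> yb"
proof -
  define W where "W = neg_part (\<mu> *\<^sub>R taylor2_vec a g b + y0)"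
  have yb: "yb = \<mu> *\<^sub>R taylor2_vec a g b + y0 + W"
    using minimax_solution_optimality(1)[OF \<mu> sol] by (simp add: W_def)
  then show yb0: "0 \<le> yb" by (simp only: W_def pos_part_nonneg)
  have ybW: "yb \<bullet> W = 0" using yb by (simp only: W_def pos_part_inner_neg_part)
  define w where "w = inverse \<mu> *\<^sub>R W"
  have "0 \<le> W" by (simp add: W_def neg_part_nonneg)
  then have w: "0 \<le> w" using \<mu> by (simp add: w_def less_eq_vec_def)
  have "\<mu> *\<^sub>R (- g b - w) + yb - y0 = - \<mu> *\<^sub>R (g b - taylor2_vec a g b)"
    using \<mu> by (subst yb) (simp add: w_def algebra_simps)
  moreover have "\<mu> *\<^sub>R grad_lagrangian b yb + b - x0 = \<mu> *\<^sub>R (grad_lagrangian b yb - model_gradient a b yb)"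
    using minimax_solution_optimality(2)[OF \<mu> sol] by (simp add: algebra_simps)
  ultimately have eq: "\<mu> *\<^sub>R (S (b, yb) - (0, w)) + (b, yb) - (x0, y0)
      = (\<mu> *\<^sub>R (grad_lagrangian b yb - model_gradient a b yb), - \<mu> *\<^sub>R (g b - taylor2_vec a g b))"
    by (simp add: S_def)
  have "\<Psi> (x0, y0) \<mu> (b, yb) \<le> merit (x0, y0) \<mu> (b, yb) w"
    using \<mu> yb0 w by (intro \<Psi>_le_merit) auto
  also have "\<dots> = (\<mu> * norm (grad_lagrangian b yb - model_gradient a b yb))\<^sup>2 + (\<mu> * norm (g b - taylor2_vec a g b))\<^sup>2"
    unfolding merit_def eq using ybW \<mu> by (simp add: norm_Pair w_def)
  finally have "sqrt (\<Psi> (x0, y0) \<mu> (b, yb)) \<le> sqrt ((\<mu> * norm (grad_lagrangian b yb - model_gradient a b yb))\<^sup>2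
      + (\<mu> * norm (g b - taylor2_vec a g b))\<^sup>2)"
    by simp
  also have "\<dots> \<le> \<mu> * norm (grad_lagrangian b yb - model_gradient a b yb) + \<mu> * norm (g b - taylor2_vec a g b)"
    using \<mu> by (intro sqrt_sum_squares_le_sum) auto
  also have "\<dots> \<le> \<mu> * ((L0 + Lg \<bullet> \<bar>yb\<bar>) / 2 * (norm (b - a))\<^sup>2) + \<mu> * (norm Lg / 6 * norm (b - a) ^ 3)"
    using \<mu> by (intro add_mono mult_left_mono model_gradient_error taylor2_vec_error) auto
  finally show "sqrt (\<Psi> (x0, y0) \<mu> (b, yb))
    \<le> \<mu> * (((L0 + Lg \<bullet> \<bar>yb\<bar>) / 2 + norm Lg / 6 * norm (b - a)) * (norm (b - a))\<^sup>2)"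
    by (simp add: distrib_left distrib_right power2_eq_square power3_eq_cube mult_ac)
qed

lemma newton_N:
  assumes \<mu>: "0 < \<mu>" and \<theta>: "0 \<le> \<theta>" "\<theta> \<le> 1/4"
    and N: "(a, y) \<in> N \<theta> (x0, y0) \<mu>"
    and sol: "minimax_solution {u. 0 \<le> u}
      (\<lambda>x' y'. taylor2 a f x' + y' \<bullet> taylor2_vec a g x'
         + ((norm (x' - x0))\<^sup>2 - (norm (y' - y0))\<^sup>2) / (2 * \<mu>)) (b, yb)"
  shows "(b, yb) \<in> N (\<theta>\<^sup>2) (x0, y0) \<mu>"
proof -
  define \<psi> where "\<psi> = sqrt (\<Psi> (x0, y0) \<mu> (a, y))"
  define \<psi>' where "\<psi>' = sqrt (\<Psi> (x0, y0) \<mu> (b, yb))"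
  define C where "C = (L0 + Lg \<bullet> \<bar>y\<bar>) / 2"
  have y: "0 \<le> y" and q: "\<mu> * quad y \<psi> \<le> \<theta>" using N by (auto simp: N_def \<psi>_def)
  have yb: "0 \<le> yb" using newton_residual(2)[OF \<mu> sol] .
  have psi0: "0 \<le> \<psi>" "0 \<le> \<psi>'" using \<Psi>_nonneg[OF \<mu>] y yb by (auto simp: \<psi>_def \<psi>'_def)
  have "norm ((b, yb) - (a, y)) \<le> \<psi>"
    unfolding \<psi>_def by (rule real_le_rsqrt[OF newton_displacement[OF \<mu> y sol]])
  then have D: "norm (b - a) \<le> \<psi>" "norm (yb - y) \<le> \<psi>"
    using norm_fst_le[of "b - a" "yb - y"] norm_snd_le[of "yb - y" "b - a"] by auto
  have "Lg \<bullet> \<bar>yb\<bar> \<le> Lg \<bullet> \<bar>y\<bar> + norm Lg * norm (yb - y)"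
    by (rule inner_le_norm_of_nonneg[OF Lg_nonneg])
  also have "\<dots> \<le> Lg \<bullet> \<bar>y\<bar> + norm Lg * \<psi>" using D by (intro add_left_mono mult_left_mono) auto
  finally have C': "(L0 + Lg \<bullet> \<bar>yb\<bar>) / 2 \<le> C + norm Lg / 2 * \<psi>" by (simp add: C_def add_divide_distrib)
  have pos: "0 \<le> (L0 + Lg \<bullet> \<bar>yb\<bar>) / 2" "0 \<le> C"
    using L0_nonneg inner_nonneg_vec[OF Lg_nonneg, of "\<bar>yb\<bar>"]
      inner_nonneg_vec[OF Lg_nonneg, of "\<bar>y\<bar>"] by (simp_all add: C_def)
  have "\<psi>' \<le> \<mu> * (((L0 + Lg \<bullet> \<bar>yb\<bar>) / 2 + norm Lg / 6 * norm (b - a)) * (norm (b - a))\<^sup>2)"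
    unfolding \<psi>'_def by (rule newton_residual(1)[OF \<mu> sol])
  also have "\<dots> \<le> \<mu> * ((C + norm Lg / 2 * \<psi> + norm Lg / 6 * \<psi>) * \<psi>\<^sup>2)"
    using \<mu> C' D psi0 pos by (intro mult_left_mono mult_mono add_mono power_mono) auto
  also have "\<dots> = (\<mu> * quad y \<psi>) * \<psi>"
    by (simp add: quad_def C_def power2_eq_square algebra_simps)
  also have "\<dots> \<le> \<theta> * \<psi>" using q psi0 by (intro mult_right_mono)
  finally have psi': "\<psi>' \<le> \<theta> * \<psi>" .
  have "\<mu> * quad yb \<psi>' \<le> \<mu> * quad yb (\<theta> * \<psi>)"
    using psi0 psi' \<mu> by (intro mult_left_mono quad_mono) auto
  also have "\<dots> = \<mu> * (((L0 + Lg \<bullet> \<bar>yb\<bar>) / 2 + 2 * norm Lg / 3 * (\<theta> * \<psi>)) * (\<theta> * \<psi>))"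
    by (simp add: quad_def)
  \<comment> \<open>Here \<theta> \<le> 1/4 enters: 1/2 + 2/3 * 1/4 = 2/3 restores the coefficient
    of \<open>quad y\<close>.\<close>
  also have "\<dots> \<le> \<mu> * (((C + norm Lg / 2 * \<psi>) + 2 * norm Lg / 3 * (1/4 * \<psi>)) * (\<theta> * \<psi>))"
    using \<mu> \<theta> psi0 C' by (intro mult_left_mono mult_right_mono add_mono) auto
  also have "\<dots> = \<theta> * (\<mu> * quad y \<psi>)"
    by (simp add: quad_def C_def algebra_simps)
  also have "\<dots> \<le> \<theta> * \<theta>" using q \<theta> by (intro mult_left_mono)
  finally show ?thesis using yb by (simp add: N_def \<psi>'_def power2_eq_square)
qed

section \<open>Neighborhoods under a change of center and stepsize\<close>

text \<open>Shifting the center along \<open>u\<close> by exactly the amount taken from the stepsize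
  leaves \<open>\<mu> *\<^sub>R u + p - z0\<close> unchanged; only the weight of the complementarity
  term drops. Hence the tilde iterate can be kept.\<close>

lemma N_extragradient:
  assumes \<mu>: "0 < \<mu>" and t: "0 \<le> t" "t < 1" and N: "p \<in> N \<theta>' z0 \<mu>"
  shows "p \<in> N \<theta>' (z0 - (t * \<mu>) *\<^sub>R (S p - (0, slack z0 \<mu> p))) ((1 - t) * \<mu>)" (is "_ \<in> N _ ?z1 ?\<mu>")
proof -
  define u where "u = S p - (0, slack z0 \<mu> p)"
  have \<mu>': "0 < ?\<mu>" using \<mu> t by simp
  have y: "0 \<le> snd p" using N by (auto simp: N_def)
  have s: "0 \<le> slack z0 \<mu> p" by (simp add: slack_def neg_part_nonneg)
  have eq: "?\<mu> *\<^sub>R u + p - (z0 - (t * \<mu>) *\<^sub>R u) = \<mu> *\<^sub>R u + p - z0"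
    by (simp add: algebra_simps)
  have "\<Psi> ?z1 ?\<mu> p \<le> merit ?z1 ?\<mu> p (slack z0 \<mu> p)"
    by (rule \<Psi>_le_merit[OF \<mu>' y s])
  also have "\<dots> = (norm (\<mu> *\<^sub>R u + p - z0))\<^sup>2 + 2 * ?\<mu> * (snd p \<bullet> slack z0 \<mu> p)"
    unfolding merit_def u_def[symmetric] eq ..
  also have "\<dots> \<le> merit z0 \<mu> p (slack z0 \<mu> p)"
    using \<mu> t inner_nonneg_vec[OF y s] unfolding merit_def u_def[symmetric]
    by (intro add_left_mono mult_right_mono) (auto simp: mult_le_cancel_right1)
  also have "\<dots> = \<Psi> z0 \<mu> p" by (rule \<Psi>_eq_merit_slack[OF \<mu>, symmetric])
  finally have "quad (snd p) (sqrt (\<Psi> ?z1 ?\<mu> p)) \<le> quad (snd p) (sqrt (\<Psi> z0 \<mu> p))"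
    using \<Psi>_nonneg[OF \<mu>' y] by (intro quad_mono) auto
  moreover have "0 \<le> quad (snd p) (sqrt (\<Psi> ?z1 ?\<mu> p))"
    using quad_mono[of 0 "sqrt (\<Psi> ?z1 ?\<mu> p)" "snd p"] \<Psi>_nonneg[OF \<mu>' y] by (simp add: quad_def)
  ultimately have "?\<mu> * quad (snd p) (sqrt (\<Psi> ?z1 ?\<mu> p)) \<le> \<mu> * quad (snd p) (sqrt (\<Psi> z0 \<mu> p))"
    using \<mu> t by (intro mult_mono) (auto simp: mult_le_cancel_right1)
  then show ?thesis using N by (simp add: N_def)
qed

lemma sqrt_\<Psi>_le_\<rho>:
  assumes "0 < \<mu>" "0 < \<alpha>" "p \<in> N \<alpha> z0 \<mu>"
  shows "sqrt (\<Psi> z0 \<mu> p) \<le> \<rho> (snd p) (\<alpha> / \<mu>)"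
  using assms by (intro le_\<rho>) (auto simp: N_def field_simps)

text \<open>With \<open>w\<close> unchanged, the new residual is
  \<open>(1 + h) *\<^sub>R u - h *\<^sub>R (p - z0)\<close>. The failed test bounds
  \<open>norm (p - z0)\<close> by \<open>r / \<sigma>\<close>, whence the factor \<beta>;
  \<open>quad\<close> grows by at most \<beta> squared, and the stepsize itself supplies
  \<open>1 + h\<close>. These are the factors of the equation defining \<open>h\<close>.\<close>

lemma N_stretch:
  assumes \<mu>: "0 < \<mu>" and \<sigma>: "0 < \<sigma>" and h: "0 \<le> h" and \<theta>: "0 < \<theta>"
    and root: "\<theta> * (1 + h) * (1 + h * (1 + 1 / \<sigma>))\<^sup>2 \<le> 1"
    and N: "p \<in> N (\<theta>\<^sup>2) z0 \<mu>"
    and small: "\<sigma> * norm (p - z0) \<le> \<rho> (snd p) (\<theta>\<^sup>2 / \<mu>)"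
  shows "p \<in> N \<theta> z0 ((1 + h) * \<mu>)"
proof -
  define r where "r = \<rho> (snd p) (\<theta>\<^sup>2 / \<mu>)"
  define s where "s = slack z0 \<mu> p"
  define u where "u = \<mu> *\<^sub>R (S p - (0, s)) + p - z0"
  define e where "e = sqrt (2 * \<mu> * (snd p \<bullet> s))"
  define \<beta> where "\<beta> = 1 + h * (1 + 1 / \<sigma>)"
  have y: "0 \<le> snd p" using N by (auto simp: N_def)
  have s: "0 \<le> s" by (simp add: s_def slack_def neg_part_nonneg)
  have \<mu>': "0 < (1 + h) * \<mu>" using \<mu> h by (intro mult_pos_pos) auto
  have e2: "e\<^sup>2 = 2 * \<mu> * (snd p \<bullet> s)"
    using \<mu> inner_nonneg_vec[OF y s] by (simp add: e_def)
  have r: "0 < r" "quad (snd p) r = \<theta>\<^sup>2 / \<mu>"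
    using \<rho>_props[of "\<theta>\<^sup>2 / \<mu>" "snd p"] \<mu> \<theta> by (auto simp: r_def)
  have "(norm (u, e))\<^sup>2 = (norm u)\<^sup>2 + e\<^sup>2" by (simp add: norm_Pair)
  \<comment> \<open>Appending \<open>e\<close> as one more coordinate makes the merit a single
    squared norm, to which the triangle inequality applies.\<close>
  then have "\<Psi> z0 \<mu> p = (norm (u, e))\<^sup>2"
    by (simp add: \<Psi>_eq_merit_slack[OF \<mu>] merit_def e2 u_def s_def)
  then have ue: "norm (u, e) \<le> r"
    using sqrt_\<Psi>_le_\<rho>[OF \<mu> _ N] \<theta> by (simp add: r_def)
  have eq: "((1 + h) * \<mu>) *\<^sub>R (S p - (0, s)) + p - z0 = (1 + h) *\<^sub>R u - h *\<^sub>R (p - z0)"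
    by (simp add: u_def algebra_simps)
  have "\<Psi> z0 ((1 + h) * \<mu>) p \<le> merit z0 ((1 + h) * \<mu>) p s"
    by (rule \<Psi>_le_merit[OF \<mu>' y s])
  also have "\<dots> = (norm ((1 + h) *\<^sub>R u - h *\<^sub>R (p - z0)))\<^sup>2 + (1 + h) * e\<^sup>2"
    unfolding merit_def eq e2 by simp
  also have "\<dots> \<le> (norm ((1 + h) *\<^sub>R u - h *\<^sub>R (p - z0)))\<^sup>2 + ((1 + h) * e)\<^sup>2"
  proof -
    have "1 * ((1 + h) * e\<^sup>2) \<le> (1 + h) * ((1 + h) * e\<^sup>2)"
      using h by (intro mult_right_mono) auto
    then show ?thesis by (simp add: power2_eq_square mult_ac)
  qed
  also have "\<dots> = (norm ((1 + h) *\<^sub>R (u, e) - h *\<^sub>R (p - z0, 0)))\<^sup>2"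
    by (simp add: norm_Pair)
  finally have "sqrt (\<Psi> z0 ((1 + h) * \<mu>) p) \<le> norm ((1 + h) *\<^sub>R (u, e) - h *\<^sub>R (p - z0, 0 :: real))"
    by (rule order_trans[OF real_sqrt_le_mono]) (simp only: real_sqrt_abs abs_norm_cancel order_refl)
  also have "\<dots> \<le> (1 + h) * norm (u, e) + h * norm (p - z0)"
  proof -
    have "norm (p - z0, 0 :: real) = norm (p - z0)" by (simp add: norm_Pair)
    then show ?thesis
      using norm_triangle_ineq4[of "(1 + h) *\<^sub>R (u, e)" "h *\<^sub>R (p - z0, 0 :: real)"] h
      by (simp only: norm_scaleR abs_of_nonneg add_nonneg_nonneg zero_le_one)
  qed
  also have "\<dots> \<le> (1 + h) * r + h * (r / \<sigma>)"
    using h ue small \<sigma> by (intro add_mono mult_left_mono) (auto simp: r_def field_simps)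
  also have "\<dots> = \<beta> * r" by (simp add: \<beta>_def algebra_simps)
  finally have psi: "sqrt (\<Psi> z0 ((1 + h) * \<mu>) p) \<le> \<beta> * r" .
  have \<beta>: "1 \<le> \<beta>" using h \<sigma> by (simp add: \<beta>_def)
  have "quad (snd p) (sqrt (\<Psi> z0 ((1 + h) * \<mu>) p)) \<le> quad (snd p) (\<beta> * r)"
    using psi \<Psi>_nonneg[OF \<mu>' y] by (intro quad_mono) auto
  also have "\<dots> \<le> \<beta>\<^sup>2 * (\<theta>\<^sup>2 / \<mu>)"
    using quad_scale_le[OF \<beta>, of r "snd p"] r by simp
  finally have "(1 + h) * \<mu> * quad (snd p) (sqrt (\<Psi> z0 ((1 + h) * \<mu>) p)) \<le> (1 + h) * \<mu> * (\<beta>\<^sup>2 * (\<theta>\<^sup>2 / \<mu>))"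
    using \<mu>' by (intro mult_left_mono) auto
  also have "\<dots> = \<theta> * (\<theta> * (1 + h) * \<beta>\<^sup>2)" using \<mu> by (simp add: power2_eq_square)
  also have "\<dots> \<le> \<theta> * 1" using root \<theta> unfolding \<beta>_def by (intro mult_left_mono) auto
  finally show ?thesis using y by (simp add: N_def)
qed

end

section \<open>Certificates\<close>

context convex_program
begin

text \<open>The saddle inclusion restricted to nonnegative \<open>y'\<close>; for all other
  \<open>y'\<close> the right-hand side with \<open>Lbar\<close> is infinite.\<close>

definition certificate where
  "certificate p u e \<longleftrightarrow> 0 \<le> snd p \<and>
    (\<forall>x' y'. 0 \<le> y' \<longrightarrow> u \<bullet> ((x', y') - p) - e \<le> lagrangian x' (snd p) - lagrangian (fst p) y')"

lemma certificate_pointwise: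
  assumes "0 \<le> snd p" "0 \<le> w"
  shows "certificate p (S p - (0, w)) (snd p \<bullet> w)"
  using assms lagrangian_saddle_inequality[of "snd p" _ w "fst p"]
  by (simp add: certificate_def)

text \<open>Averaging works because the Lagrangian is affine in the multiplier and, for nonnegative
  \<open>y'\<close>, convex in the primal variable. The covariance term in the error is what turns
  the average of the affine minorants into one with slope \<open>ua\<close> based at
  \<open>pa\<close>.\<close>

lemma certificate_ergodic:
  assumes S: "finite J" and a: "\<And>j. j \<in> J \<Longrightarrow> 0 \<le> a j" "sum a J = 1"
    and cert: "\<And>j. j \<in> J \<Longrightarrow> certificate (p j) (u j) (e j)"
  defines "pa \<equiv> \<Sum>j\<in>J. a j *\<^sub>R p j" and "ua \<equiv> \<Sum>j\<in>J. a j *\<^sub>R u j"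
  shows "certificate pa ua (\<Sum>j\<in>J. a j * (e j + (p j - pa) \<bullet> (u j - ua)))"
proof -
  have J: "J \<noteq> {}" using a(2) by auto
  have fst_pa: "fst pa = (\<Sum>j\<in>J. a j *\<^sub>R fst (p j))" and snd_pa: "snd pa = (\<Sum>j\<in>J. a j *\<^sub>R snd (p j))"
    by (simp_all add: pa_def fst_sum snd_sum)
  have y: "0 \<le> snd pa"
    using a(1) cert unfolding snd_pa
    by (auto simp: certificate_def less_eq_vec_def intro!: sum_nonneg)
  \<comment> \<open>Deviations from the mean sum to zero, so \<open>ua\<close> may be dropped from
    the covariance term.\<close>
  have "(\<Sum>j\<in>J. a j *\<^sub>R (p j - pa)) = (\<Sum>j\<in>J. a j *\<^sub>R p j) - (sum a J) *\<^sub>R pa"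
    by (simp add: scaleR_diff_right sum_subtractf scaleR_left.sum)
  then have centered: "(\<Sum>j\<in>J. a j *\<^sub>R (p j - pa)) = 0" by (simp add: a(2) pa_def)
  have "(\<Sum>j\<in>J. a j * (e j + (p j - pa) \<bullet> (u j - ua)))
      = (\<Sum>j\<in>J. a j * (e j + (p j - pa) \<bullet> u j)) - (\<Sum>j\<in>J. a j *\<^sub>R (p j - pa)) \<bullet> ua"
    by (simp add: inner_diff_right inner_sum_left sum_subtractf sum.distrib algebra_simps)
  then have eps: "(\<Sum>j\<in>J. a j * (e j + (p j - pa) \<bullet> (u j - ua))) = (\<Sum>j\<in>J. a j * (e j + (p j - pa) \<bullet> u j))"
    by (simp add: centered)
  have "ua \<bullet> ((x', y') - pa) - (\<Sum>j\<in>J. a j * (e j + (p j - pa) \<bullet> u j))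
      \<le> lagrangian x' (snd pa) - lagrangian (fst pa) y'" if y': "0 \<le> y'" for x' y'
  proof -
    have "ua \<bullet> ((x', y') - pa) - (\<Sum>j\<in>J. a j * (e j + (p j - pa) \<bullet> u j))
        = (\<Sum>j\<in>J. a j * (u j \<bullet> ((x', y') - p j) - e j))"
      unfolding ua_def inner_sum_left sum_subtractf[symmetric]
      by (intro sum.cong refl) (simp add: inner_diff_right inner_diff_left inner_commute algebra_simps)
    also have "\<dots> \<le> (\<Sum>j\<in>J. a j * (lagrangian x' (snd (p j)) - lagrangian (fst (p j)) y'))"
      using a(1) cert y' by (intro sum_mono mult_left_mono) (auto simp: certificate_def)
    also have "\<dots> = (\<Sum>j\<in>J. a j * lagrangian x' (snd (p j))) - (\<Sum>j\<in>J. a j * lagrangian (fst (p j)) y')"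
      by (simp add: right_diff_distrib sum_subtractf)
    also have "(\<Sum>j\<in>J. a j * lagrangian x' (snd (p j))) = lagrangian x' (snd pa)"
      by (simp add: lagrangian_def distrib_left sum.distrib snd_pa inner_sum_left a(2) flip: sum_distrib_right)
    finally have upper: "ua \<bullet> ((x', y') - pa) - (\<Sum>j\<in>J. a j * (e j + (p j - pa) \<bullet> u j))
        \<le> lagrangian x' (snd pa) - (\<Sum>j\<in>J. a j * lagrangian (fst (p j)) y')" .
    have "lagrangian (fst pa) y' \<le> (\<Sum>j\<in>J. a j * lagrangian (fst (p j)) y')"
    proof -
      have "f (fst pa) \<le> (\<Sum>j\<in>J. a j * f (fst (p j)))"
        unfolding fst_pa using S J a by (intro convex_on_sum[OF _ _ f_convex]) auto
      moreover have "g (fst pa) $ i \<le> (\<Sum>j\<in>J. a j * g (fst (p j)) $ i)" for i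
        unfolding fst_pa using S J a by (intro convex_on_sum[OF _ _ g_convex]) auto
      then have "(\<Sum>i\<in>UNIV. y' $ i * g (fst pa) $ i) \<le> (\<Sum>i\<in>UNIV. y' $ i * (\<Sum>j\<in>J. a j * g (fst (p j)) $ i))"
        using y' by (intro sum_mono mult_left_mono) (auto simp: less_eq_vec_def)
      then have "y' \<bullet> g (fst pa) \<le> (\<Sum>i\<in>UNIV. \<Sum>j\<in>J. a j * (y' $ i * g (fst (p j)) $ i))"
        by (simp add: inner_vec_def sum_distrib_left mult_ac)
      then have "y' \<bullet> g (fst pa) \<le> (\<Sum>j\<in>J. a j * (y' \<bullet> g (fst (p j))))"
        by (subst (asm) sum.swap) (simp add: inner_vec_def sum_distrib_left)
      ultimately show ?thesis by (simp add: lagrangian_def distrib_left sum.distrib)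
    qed
    then show ?thesis using upper by simp
  qed
  then show ?thesis using y by (simp add: certificate_def eps)
qed

lemma certificate_subdifferential:
  assumes "certificate (a, y) u e"
  shows "u \<in> eps_subdifferential e (\<lambda>(b, s). Lbar b y - Lbar a s) (a, y)"
proof -
  have y: "0 \<le> y" using assms by (simp add: certificate_def)
  have "(Lbar a y - Lbar a y) + ereal (u \<bullet> ((b, s) - (a, y)) - e) \<le> Lbar b y - Lbar a s" for b s
  proof (cases "0 \<le> s")
    case True
    then have "u \<bullet> ((b, s) - (a, y)) - e \<le> lagrangian b y - lagrangian a s"
      using assms by (simp add: certificate_def)
    then show ?thesis using y True by (simp add: Lbar_def lagrangian_def)
  qed (simp add: Lbar_def y)
  then show ?thesis by (auto simp: eps_subdifferential_def)
qed

text \<open>Specialize the saddle inequality to \<open>y' = 0\<close>, and to \<open>x' = x\<close> with \<open>y'\<close> running along rays.\<close>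

lemma certificate_componentwise:
  assumes "certificate (a, y) (p, q) e"
  shows "0 \<le> y"
    and "p \<in> eps_subdifferential (e + y \<bullet> (g a + q)) (\<lambda>b. Lbar b y) a"
    and "g a + q \<le> 0" and "- e \<le> y \<bullet> (g a + q)"
proof -
  show y: "0 \<le> y" using assms by (simp add: certificate_def)
  have ineq: "f a + y \<bullet> g a + (p \<bullet> (b - a) - (e + y \<bullet> (g a + q))) + y' \<bullet> (g a + q) \<le> f b + y \<bullet> g b"
    if "0 \<le> y'" for b y'
  proof -
    have "(p, q) \<bullet> ((b, y') - (a, y)) - e \<le> lagrangian b y - lagrangian a y'"
      using assms that by (simp add: certificate_def)
    then show ?thesis by (simp add: lagrangian_def inner_add_right inner_diff_right inner_commute)
  qed
  show "p \<in> eps_subdifferential (e + y \<bullet> (g a + q)) (\<lambda>b. Lbar b y) a"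
    using ineq[of 0] y by (simp add: eps_subdifferential_def Lbar_def)
  show "- e \<le> y \<bullet> (g a + q)"
    using ineq[of 0 a] by simp
  have ray: "y' \<bullet> (g a + q) \<le> e + y \<bullet> (g a + q)" if "0 \<le> y'" for y'
    using ineq[OF that, of a] by simp
  have "(g a + q) $ i \<le> 0" for i
  proof (rule ccontr)
    assume pos: "\<not> ?thesis"
    \<comment> \<open>Scaled so that the product along this axis exceeds the bound in
      \<open>ray\<close>.\<close>
    define t where "t = (\<bar>e + y \<bullet> (g a + q)\<bar> + 1) / (g a + q) $ i"
    have t: "0 \<le> t" using pos by (simp add: t_def)
    have "axis i t \<bullet> (g a + q) = t * (g a + q) $ i" by (simp only: inner_axis' inner_real_def)
    moreover have "0 \<le> axis i t" using t by (auto simp: less_eq_vec_def axis_def)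
    ultimately have "t * (g a + q) $ i \<le> e + y \<bullet> (g a + q)" using ray by metis
    moreover have "t * (g a + q) $ i = \<bar>e + y \<bullet> (g a + q)\<bar> + 1"
      using pos unfolding t_def by (simp only: nonzero_eq_divide_eq times_divide_eq_left) simp
    ultimately show False by linarith
  qed
  then show "g a + q \<le> 0" by (simp add: less_eq_vec_def)
qed

end

section \<open>Relaxed hybrid proximal extragradient steps\<close>

text \<open>An exact identity combined with the error criterion; the discarded term
  \<open>T * (1 - T) * (norm (l *\<^sub>R u))\<^sup>2\<close> is where relaxation needs
  \<open>T\<close> in the unit interval. The point \<open>s\<close> is arbitrary: a solution gives
  Fejer monotonicity, the ergodic mean gives the bound on \<open>eps_erg\<close>.\<close>

lemma relaxed_hpe_step:
  fixes p t s u :: "'a::real_inner"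
  assumes T: "0 \<le> T" "T \<le> 1"
    and err: "(norm (l *\<^sub>R u + t - p))\<^sup>2 + 2 * l * e \<le> (\<sigma> * norm (t - p))\<^sup>2"
  shows "(norm (p - (T * l) *\<^sub>R u - s))\<^sup>2 + 2 * (T * l) * (u \<bullet> (t - s) + e)
      + T * (1 - \<sigma>\<^sup>2) * (norm (t - p))\<^sup>2 \<le> (norm (p - s))\<^sup>2"
proof -
  have "(norm (p - (T * l) *\<^sub>R u - s))\<^sup>2 + 2 * (T * l) * (u \<bullet> (t - s) + e)
      = (norm (p - s))\<^sup>2 + T * ((norm (l *\<^sub>R u + t - p))\<^sup>2 + 2 * l * e - (norm (t - p))\<^sup>2)
        - T * (1 - T) * (norm (l *\<^sub>R u))\<^sup>2"
    unfolding power2_norm_eq_inner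
    by (simp add: inner_add_left inner_add_right inner_diff_left inner_diff_right inner_commute algebra_simps)
  also have "\<dots> \<le> (norm (p - s))\<^sup>2 + T * ((\<sigma> * norm (t - p))\<^sup>2 - (norm (t - p))\<^sup>2)"
  proof -
    have "T * ((norm (l *\<^sub>R u + t - p))\<^sup>2 + 2 * l * e - (norm (t - p))\<^sup>2)
        \<le> T * ((\<sigma> * norm (t - p))\<^sup>2 - (norm (t - p))\<^sup>2)"
      using T(1) err by (intro mult_left_mono) auto
    moreover have "0 \<le> T * (1 - T) * (norm (l *\<^sub>R u))\<^sup>2" using T by simp
    ultimately show ?thesis by linarith
  qed
  finally show ?thesis by (simp add: power_mult_distrib algebra_simps)
qed

text \<open>Both bounds come from the full step \<open>T = 1\<close>, whose end point need not be an
  iterate. The second uses \<open>norm (t - s) \<le> \<sigma> * n + Q\<close>, and the subtracted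
  square in its computation is the defect in the Cauchy-Schwarz inequality.\<close>

lemma hpe_distances:
  fixes p t s u :: "'a::real_inner"
  assumes \<sigma>: "0 \<le> \<sigma>" "\<sigma> < 1" and l: "0 \<le> l" and e: "0 \<le> e"
    and err: "(norm (l *\<^sub>R u + t - p))\<^sup>2 + 2 * l * e \<le> (\<sigma> * norm (t - p))\<^sup>2"
    and s: "- e \<le> u \<bullet> (t - s)"
  shows "sqrt (1 - \<sigma>\<^sup>2) * norm (t - p) \<le> norm (p - s)"
    and "sqrt (1 - \<sigma>\<^sup>2) * norm (t - s) \<le> norm (p - s)"
proof -
  define n where "n = norm (t - p)"
  define Q where "Q = norm (p - l *\<^sub>R u - s)"
  have \<sigma>2: "0 \<le> 1 - \<sigma>\<^sup>2" using \<sigma> by (simp add: power_le_one)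
  have "0 \<le> l * (u \<bullet> (t - s) + e)" using l s by simp
  then have descent: "Q\<^sup>2 + (1 - \<sigma>\<^sup>2) * n\<^sup>2 \<le> (norm (p - s))\<^sup>2"
    using relaxed_hpe_step[of 1, OF _ _ err, of s] by (simp add: Q_def n_def)
  then have "(1 - \<sigma>\<^sup>2) * n\<^sup>2 \<le> (norm (p - s))\<^sup>2" using zero_le_power2[of Q] by linarith
  then show "sqrt (1 - \<sigma>\<^sup>2) * norm (t - p) \<le> norm (p - s)"
    using \<sigma>2 by - (rule power2_le_imp_le, simp_all add: power_mult_distrib n_def)
  have "(norm (l *\<^sub>R u + t - p))\<^sup>2 \<le> (\<sigma> * n)\<^sup>2"
    using err mult_nonneg_nonneg[OF l e] by (simp add: n_def)
  then have "norm (l *\<^sub>R u + t - p) \<le> \<sigma> * n"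
    using \<sigma> by - (rule power2_le_imp_le, simp_all add: n_def)
  moreover have "norm (t - s) \<le> norm (l *\<^sub>R u + t - p) + Q"
    unfolding Q_def by (rule order_trans[OF _ norm_triangle_ineq]) simp
  ultimately have "norm (t - s) \<le> \<sigma> * n + Q" by simp
  then have "(1 - \<sigma>\<^sup>2) * (norm (t - s))\<^sup>2 \<le> (1 - \<sigma>\<^sup>2) * (\<sigma> * n + Q)\<^sup>2"
    using \<sigma>2 by (intro mult_left_mono power_mono) auto
  also have "\<dots> = Q\<^sup>2 + (1 - \<sigma>\<^sup>2) * n\<^sup>2 - (\<sigma> * Q - (1 - \<sigma>\<^sup>2) * n)\<^sup>2"
    by (simp add: power2_eq_square algebra_simps)
  also have "\<dots> \<le> (norm (p - s))\<^sup>2"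
    using descent zero_le_power2[of "\<sigma> * Q - (1 - \<sigma>\<^sup>2) * n"] by linarith
  finally show "sqrt (1 - \<sigma>\<^sup>2) * norm (t - s) \<le> norm (p - s)"
    using \<sigma>2 by - (rule power2_le_imp_le, simp_all add: power_mult_distrib)
qed

text \<open>Summing the tangent inequality \<open>1 / b\<^sup>2 \<ge> 3 t\<^sup>2 - 2 t\<^sup>3 b\<close> of the convex function \<open>1 / b\<^sup>2\<close>
  at the mean \<open>1 / t\<close>.\<close>

lemma card_cube_le_sum:
  fixes a :: "'b \<Rightarrow> real"
  assumes J: "finite J" "J \<noteq> {}" and a: "\<And>j. j \<in> J \<Longrightarrow> 0 < a j"
  shows "real (card J) ^ 3 \<le> (sum a J)\<^sup>2 * (\<Sum>j\<in>J. 1 / (a j)\<^sup>2)"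
proof -
  have pos: "0 < sum a J" using J a by (intro sum_pos) auto
  define t where "t = real (card J) / sum a J"
  have tangent: "3 * t\<^sup>2 - 2 * t ^ 3 * b \<le> 1 / b\<^sup>2" if b: "0 < b" for b
  proof -
    have "0 \<le> (1 - t * b)\<^sup>2 * (1 + 2 * (t * b)) / b\<^sup>2"
      using b pos by (simp add: t_def)
    also have "(1 - t * b)\<^sup>2 * (1 + 2 * (t * b)) = 1 - (3 * t\<^sup>2 - 2 * t ^ 3 * b) * b\<^sup>2"
      by (simp add: power2_eq_square power3_eq_cube algebra_simps)
    also have "\<dots> / b\<^sup>2 = 1 / b\<^sup>2 - (3 * t\<^sup>2 - 2 * t ^ 3 * b)"
      using b by (simp add: diff_divide_distrib)
    finally show ?thesis by simp
  qed
  have card: "real (card J) = t * sum a J" using pos by (simp add: t_def)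
  have "t ^ 3 * sum a J = 3 * t\<^sup>2 * real (card J) - 2 * t ^ 3 * sum a J"
    unfolding card by (simp add: power2_eq_square power3_eq_cube)
  also have "\<dots> = (\<Sum>j\<in>J. 3 * t\<^sup>2 - 2 * t ^ 3 * a j)"
    by (simp add: sum_subtractf sum_distrib_left)
  also have "\<dots> \<le> (\<Sum>j\<in>J. 1 / (a j)\<^sup>2)" by (intro sum_mono tangent a)
  finally have "(sum a J)\<^sup>2 * (t ^ 3 * sum a J) \<le> (sum a J)\<^sup>2 * (\<Sum>j\<in>J. 1 / (a j)\<^sup>2)"
    by (intro mult_left_mono) auto
  moreover have "real (card J) ^ 3 = (sum a J)\<^sup>2 * (t ^ 3 * sum a J)"
    unfolding card by (simp add: power2_eq_square power3_eq_cube)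
  ultimately show ?thesis by simp
qed

text \<open>Links \<open>kk\<close>, which enumerates the possibly infinite \<open>A\<close>, to
  finite initial parts. Removing the least element commutes with cutting off at \<open>s\<close>;
  the bound on \<open>n\<close> keeps \<open>LEAST\<close> away from the empty set.\<close>

lemma enumerate_initial_segment:
  fixes A :: "'b::wellorder set"
  assumes "n < card (A \<inter> {..<s})"
  shows "enumerate (A \<inter> {..<s}) n = enumerate A n"
  using assms
proof (induction n arbitrary: A)
  case (0 A)
  then have ne: "\<exists>a. a \<in> A \<inter> {..<s}" by (metis all_not_in_conv card.empty less_irrefl)
  have "(LEAST a. a \<in> A) = (LEAST a. a \<in> A \<inter> {..<s})"
  proof (rule Least_equality)
    show "(LEAST a. a \<in> A \<inter> {..<s}) \<in> A" using LeastI_ex[OF ne] by blast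
    show "(LEAST a. a \<in> A \<inter> {..<s}) \<le> b" if "b \<in> A" for b
    proof (cases "b < s")
      case True
      then show ?thesis using that by (intro Least_le) simp
    next
      case False
      then show ?thesis using LeastI_ex[OF ne] by auto
    qed
  qed
  then show ?case by (simp add: enumerate_0)
next
  case (Suc n A)
  have ne: "\<exists>a. a \<in> A \<inter> {..<s}" using Suc.prems by (metis all_not_in_conv card.empty not_less0)
  define m where "m = (LEAST a. a \<in> A \<inter> {..<s})"
  have m: "m \<in> A \<inter> {..<s}" unfolding m_def by (rule LeastI_ex[OF ne])
  have "(LEAST a. a \<in> A) = m"
  proof (rule Least_equality)
    show "m \<le> b" if "b \<in> A" for b
    proof (cases "b < s")
      case True
      then show ?thesis using that unfolding m_def by (intro Least_le) simp
    qed (use m in auto)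
  qed (use m in simp)
  moreover have "A \<inter> {..<s} - {m} = (A - {m}) \<inter> {..<s}" by blast
  moreover have "n < card ((A - {m}) \<inter> {..<s})"
    unfolding calculation(2)[symmetric] using Suc.prems m by (simp add: card_Diff_singleton)
  ultimately show ?case using Suc.IH[of "A - {m}"] by (simp add: enumerate_Suc m_def)
qed

section \<open>Analysis of the algorithm\<close>

context algorithm1
begin

lemma \<tau>_bounds: "0 < \<tau>" "\<tau> < 1" "inverse (1 - \<tau>) = 1 + h"
  using h_pos by (auto simp: \<tau>_eq field_simps)

lemma slack_eq_w: "slack (z (k - 1)) (lam k) (zt k) = w k"
  by (simp add: slack_def w_def z_def zt_def)

lemma w_nonneg: "0 \<le> w k"
  by (simp add: w_def neg_part_nonneg)

text \<open>Positive homogeneity of the negative part turns the multiplier update into a step along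
  the second component of \<open>v k\<close>.\<close>

lemma extragradient_step_z:
  assumes "0 < lam k" "extragradient_step k"
  shows "z k = z (k - 1) - (\<tau> * lam k) *\<^sub>R v k"
proof -
  have "lam k *\<^sub>R g (xt k) + y (k - 1) = lam k *\<^sub>R (g (xt k) + inverse (lam k) *\<^sub>R y (k - 1))"
    using assms(1) by (simp add: algebra_simps)
  then have "neg_part (lam k *\<^sub>R g (xt k) + y (k - 1)) = lam k *\<^sub>R w k"
    using assms(1) by (simp add: neg_part_scaleR w_def)
  then show ?thesis
    using assms(2) unfolding extragradient_step_def
    by (simp add: z_def zt_def v_def S_def algebra_simps)
qed

lemma invariant:
  assumes "1 \<le> k"
  shows "0 < lam k \<and> zt k \<in> N (\<theta>\<^sup>2) (z (k - 1)) (lam k)"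
  using assms
proof (induction k rule: nat_induct_at_least)
  case base
  then show ?case using lam1_pos start_N by simp
next
  case (Suc k)
  then have lam: "0 < lam k" and N: "zt k \<in> N (\<theta>\<^sup>2) (z (k - 1)) (lam k)" by auto
  show ?case
  proof (cases "k \<in> A")
    case True
    then have st: "extragradient_step k" using step[OF Suc.hyps] by simp
    then have "lam (Suc k) = (1 - \<tau>) * lam k" "zt (Suc k) = zt k"
      by (simp_all add: extragradient_step_def zt_def)
    moreover have "zt k \<in> N (\<theta>\<^sup>2) (z k) ((1 - \<tau>) * lam k)"
      using N_extragradient[OF lam less_imp_le[OF \<tau>_bounds(1)] \<tau>_bounds(2) N]
      unfolding slack_eq_w v_def[symmetric] extragradient_step_z[OF lam st, symmetric] .
    ultimately show ?thesis using lam \<tau>_bounds by simp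
  next
    case False
    then have st: "newton_step k" using step[OF Suc.hyps] by simp
    then have lam': "lam (Suc k) = (1 + h) * lam k" and z: "z (k - 1) = z k"
      by (simp_all add: newton_step_def \<tau>_bounds(3) z_def)
    have pos: "0 < lam (Suc k)" using lam h_pos by (simp add: lam')
    have "\<sigma> * norm (zt k - z (k - 1)) \<le> \<rho> (snd (zt k)) (\<theta>\<^sup>2 / lam k)"
      using False Suc.hyps by (simp add: A_def zt_def)
    then have "(xt k, yt k) \<in> N \<theta> (x k, y k) (lam (Suc k))"
      using N_stretch[OF lam \<sigma>_bounds(1) less_imp_le[OF h_pos] \<theta>_bounds(1) _ N] h_root z
      by (simp add: lam' zt_def z_def)
    moreover have "minimax_solution {u. 0 \<le> u}
      (\<lambda>x' y'. taylor2 (xt k) f x' + y' \<bullet> taylor2_vec (xt k) g x'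
         + ((norm (x' - x k))\<^sup>2 - (norm (y' - y k))\<^sup>2) / (2 * lam (Suc k))) (xt (Suc k), yt (Suc k))"
      using st unfolding newton_step_def Suc_eq_plus1 by blast
    ultimately have "(xt (Suc k), yt (Suc k)) \<in> N (\<theta>\<^sup>2) (x k, y k) (lam (Suc k))"
      using newton_N[OF pos] \<theta>_bounds by simp
    then show ?thesis using pos by (simp add: zt_def z_def)
  qed
qed

lemma lam_pos: "1 \<le> k \<Longrightarrow> 0 < lam k"
  using invariant by blast

lemma yt_nonneg: "1 \<le> k \<Longrightarrow> 0 \<le> yt k"
  using invariant[of k] by (auto simp: N_def zt_def)

lemma eps_nonneg: "1 \<le> k \<Longrightarrow> 0 \<le> eps k"
  by (simp add: eps_def inner_nonneg_vec yt_nonneg w_nonneg)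

lemma certificate_iterate: "1 \<le> k \<Longrightarrow> certificate (zt k) (v k) (eps k)"
  using certificate_pointwise[of "zt k" "w k"] yt_nonneg w_nonneg by (simp add: v_def eps_def zt_def)

definition rho where "rho k = \<rho> (yt k) (\<theta>\<^sup>2 / lam k)"

lemma rho_pos: "1 \<le> k \<Longrightarrow> 0 < rho k"
  and quad_rho: "1 \<le> k \<Longrightarrow> quad (yt k) (rho k) = \<theta>\<^sup>2 / lam k"
  unfolding rho_def using \<rho>_props[of "\<theta>\<^sup>2 / lam k"] lam_pos \<theta>_bounds by auto

lemma residual_bound:
  assumes "1 \<le> k"
  shows "(norm (lam k *\<^sub>R v k + zt k - z (k - 1)))\<^sup>2 + 2 * lam k * eps k \<le> (rho k)\<^sup>2"
proof -
  have lam: "0 < lam k" and N: "zt k \<in> N (\<theta>\<^sup>2) (z (k - 1)) (lam k)" using invariant[OF assms] by auto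
  have "sqrt (\<Psi> (z (k - 1)) (lam k) (zt k)) \<le> rho k"
    using sqrt_\<Psi>_le_\<rho>[OF lam _ N] \<theta>_bounds by (simp add: rho_def zt_def)
  then have "\<Psi> (z (k - 1)) (lam k) (zt k) \<le> (rho k)\<^sup>2"
    by (rule sqrt_le_D)
  then show ?thesis
    unfolding \<Psi>_eq_merit_slack[OF lam] merit_def slack_eq_w by (simp add: v_def eps_def zt_def)
qed

lemma hpe_error:
  assumes "k \<in> A"
  shows "(norm (lam k *\<^sub>R v k + zt k - z (k - 1)))\<^sup>2 + 2 * lam k * eps k
    \<le> (\<sigma> * norm (zt k - z (k - 1)))\<^sup>2"
proof -
  have k: "1 \<le> k" and "rho k \<le> \<sigma> * norm (zt k - z (k - 1))"
    using assms by (auto simp: A_def rho_def)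
  then have "(rho k)\<^sup>2 \<le> (\<sigma> * norm (zt k - z (k - 1)))\<^sup>2"
    using rho_pos[OF k] by (intro power_mono) auto
  then show ?thesis using residual_bound[OF k] by simp
qed

lemma z_A: "k \<in> A \<Longrightarrow> z k = z (k - 1) - (\<tau> * lam k) *\<^sub>R v k"
  using step[of k] extragradient_step_z[OF lam_pos] by (simp add: A_def)

lemma z_not_A: "1 \<le> k \<Longrightarrow> k \<notin> A \<Longrightarrow> z k = z (k - 1)"
  using step[of k] by (simp add: newton_step_def z_def)

section \<open>Extragradient indices: telescoping and counting\<close>

definition J where "J k = A \<inter> {1..k}"

lemma finite_J: "finite (J k)"
  by (simp add: J_def)

lemma J_0: "J 0 = {}"
  by (simp add: J_def)

lemma J_Suc: "J (Suc k) = (if Suc k \<in> A then insert (Suc k) (J k) else J k)"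
  by (auto simp: J_def le_Suc_eq)

lemma Suc_notin_J: "Suc k \<notin> J k"
  by (simp add: J_def)

lemma J_pos: "j \<in> J k \<Longrightarrow> 1 \<le> j" "j \<in> J k \<Longrightarrow> j \<in> A"
  by (auto simp: J_def)

lemma z_eq_sum: "z k = z 0 - (\<Sum>j\<in>J k. (\<tau> * lam j) *\<^sub>R v j)"
  by (induction k)
    (auto simp: J_0 J_Suc finite_J Suc_notin_J z_A z_not_A algebra_simps)

lemma telescope:
  "(norm (z k - s))\<^sup>2 + (\<Sum>j\<in>J k. 2 * (\<tau> * lam j) * (v j \<bullet> (zt j - s) + eps j)
      + \<tau> * (1 - \<sigma>\<^sup>2) * (norm (zt j - z (j - 1)))\<^sup>2) \<le> (norm (z 0 - s))\<^sup>2"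
proof (induction k)
  case (Suc k)
  show ?case
  proof (cases "Suc k \<in> A")
    case True
    show ?thesis
      using relaxed_hpe_step[OF _ _ hpe_error[OF True], of \<tau> s] \<tau>_bounds Suc z_A[OF True]
      by (simp add: J_Suc True finite_J Suc_notin_J)
  next
    case False
    then show ?thesis using Suc z_not_A[of "Suc k"] by (simp add: J_Suc)
  qed
qed (simp add: J_0)

text \<open>An index in \<open>A\<close> undoes one stepsize increase, so among \<open>k\<close>
  steps the net number of increases is \<open>k\<close> minus twice the number of indices in
  \<open>A\<close>. It may be negative, hence \<open>powr\<close>.\<close>

lemma lam_Suc_eq:
  "lam (Suc k) = lam 1 * (1 / (1 - \<tau>)) powr (real k - 2 * real (card (J k)))"
proof (induction k)
  case (Suc k)
  define b where "b = 1 / (1 - \<tau>)"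
  have b: "0 < b" using \<tau>_bounds by (simp add: b_def)
  have r: "b powr (r - 1) = (1 - \<tau>) * b powr r" "b powr (r + 1) = inverse (1 - \<tau>) * b powr r" for r
    using b by (simp_all add: powr_diff powr_add b_def field_simps)
  show ?case
  proof (cases "Suc k \<in> A")
    case True
    then have "lam (Suc (Suc k)) = (1 - \<tau>) * lam (Suc k)"
      using step[of "Suc k"] by (simp add: extragradient_step_def)
    also have "\<dots> = lam 1 * b powr (real k - 2 * real (card (J k)) - 1)"
      unfolding r(1) using Suc by (simp add: b_def)
    finally show ?thesis using True by (simp add: J_Suc finite_J Suc_notin_J b_def)
  next
    case False
    then have "lam (Suc (Suc k)) = inverse (1 - \<tau>) * lam (Suc k)"
      using step[of "Suc k"] by (simp add: newton_step_def)
    also have "\<dots> = lam 1 * b powr (real k - 2 * real (card (J k)) + 1)"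
      unfolding r(2) using Suc by (simp add: b_def)
    finally show ?thesis using False by (simp add: J_Suc b_def algebra_simps)
  qed
qed (use \<tau>_bounds in \<open>simp add: J_0\<close>)

lemma bij_kk: "bij_betw kk {1..card (J k)} (J k)"
proof -
  have J: "J k = A \<inter> {..<Suc k}" by (auto simp: J_def A_def)
  have "bij_betw (enumerate (J k)) {..<card (J k)} (J k)"
    by (rule finite_bij_enumerate[OF finite_J])
  then have "bij_betw (enumerate A) {..<card (J k)} (J k)"
    by (rule bij_betw_cong[THEN iffD1, rotated]) (use enumerate_initial_segment[of _ A "Suc k"] J in auto)
  moreover have "bij_betw (\<lambda>i. i - 1) {1..card (J k)} {..<card (J k)}"
    by (rule bij_betwI[of _ _ _ Suc]) auto
  ultimately have "bij_betw (enumerate A \<circ> (\<lambda>i. i - 1)) {1..card (J k)} (J k)"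
    by (rule bij_betw_trans[rotated])
  then show ?thesis by (simp add: kk_def[abs_def] o_def)
qed

lemma sum_kk: "(\<Sum>j=1..card (J k). F (kk j)) = sum F (J k)"
  by (rule sum.reindex_bij_betw[OF bij_kk])

lemma card_J_in_I:
  assumes "J k \<noteq> {}"
  shows "card (J k) \<in> I" "kk (card (J k)) \<le> k"
proof -
  have pos: "1 \<le> card (J k)" using assms finite_J by (simp add: Suc_le_eq card_gt_0_iff)
  then show "card (J k) \<in> I" by (auto simp: I_def J_def intro: card_mono)
  have "kk (card (J k)) \<in> J k"
    using bij_betwE[OF bij_kk] pos by auto
  then show "kk (card (J k)) \<le> k" by (simp add: J_def)
qed

section \<open>Fejer monotonicity and distances to a solution\<close>

lemma residual_inner_solution:
  assumes "s \<in> KKT" "1 \<le> k"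
  shows "- eps k \<le> v k \<bullet> (zt k - s)"
  using residual_inner_KKT[of "fst s" "snd s" "yt k" "w k" "xt k"] assms yt_nonneg w_nonneg
  by (simp add: v_def zt_def eps_def)

lemma fejer:
  assumes s: "s \<in> KKT"
  shows "norm (z k - s) \<le> norm (z 0 - s)"
    and "\<tau> * (1 - \<sigma>\<^sup>2) * (\<Sum>j\<in>J k. (norm (zt j - z (j - 1)))\<^sup>2) \<le> (norm (z 0 - s))\<^sup>2"
proof -
  have \<sigma>2: "0 < 1 - \<sigma>\<^sup>2" using \<sigma>_bounds by (simp add: power_less_one_iff)
  have "(\<Sum>j\<in>J k. \<tau> * (1 - \<sigma>\<^sup>2) * (norm (zt j - z (j - 1)))\<^sup>2) \<le> (\<Sum>j\<in>J k. 2 * (\<tau> * lam j) * (v j \<bullet> (zt j - s) + eps j)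
      + \<tau> * (1 - \<sigma>\<^sup>2) * (norm (zt j - z (j - 1)))\<^sup>2)"
    using residual_inner_solution[OF s] lam_pos \<tau>_bounds
    by (intro sum_mono) (auto dest!: J_pos(1) simp: less_imp_le intro!: mult_nonneg_nonneg, smt (verit))
  then have sum: "(norm (z k - s))\<^sup>2 + \<tau> * (1 - \<sigma>\<^sup>2) * (\<Sum>j\<in>J k. (norm (zt j - z (j - 1)))\<^sup>2) \<le> (norm (z 0 - s))\<^sup>2"
    using telescope[of k s] by (simp add: sum_distrib_left)
  moreover have "0 \<le> \<tau> * (1 - \<sigma>\<^sup>2) * (\<Sum>j\<in>J k. (norm (zt j - z (j - 1)))\<^sup>2)"
    using \<tau>_bounds \<sigma>2 by (intro mult_nonneg_nonneg sum_nonneg) auto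
  ultimately have "(norm (z k - s))\<^sup>2 \<le> (norm (z 0 - s))\<^sup>2" by linarith
  then show "norm (z k - s) \<le> norm (z 0 - s)" by (rule power2_le_imp_le) simp
  show "\<tau> * (1 - \<sigma>\<^sup>2) * (\<Sum>j\<in>J k. (norm (zt j - z (j - 1)))\<^sup>2) \<le> (norm (z 0 - s))\<^sup>2"
    using sum zero_le_power2[of "norm (z k - s)"] by linarith
qed

lemma distances:
  assumes s: "s \<in> KKT" and k: "k \<in> A"
  shows "norm (zt k - z (k - 1)) \<le> norm (z 0 - s) / sqrt (1 - \<sigma>\<^sup>2)"
    and "norm (zt k - s) \<le> norm (z 0 - s) / sqrt (1 - \<sigma>\<^sup>2)"
proof -
  have k1: "1 \<le> k" using k by (simp add: A_def)
  have \<sigma>2: "0 < 1 - \<sigma>\<^sup>2" using \<sigma>_bounds by (simp add: power_less_one_iff)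
  note * = hpe_distances[OF less_imp_le[OF \<sigma>_bounds(1)] \<sigma>_bounds(2) less_imp_le[OF lam_pos[OF k1]]
      eps_nonneg[OF k1] hpe_error[OF k] residual_inner_solution[OF s k1]]
  show "norm (zt k - z (k - 1)) \<le> norm (z 0 - s) / sqrt (1 - \<sigma>\<^sup>2)"
    using order_trans[OF *(1) fejer(1)[OF s]] \<sigma>2 by (simp add: pos_le_divide_eq mult.commute)
  show "norm (zt k - s) \<le> norm (z 0 - s) / sqrt (1 - \<sigma>\<^sup>2)"
    using order_trans[OF *(2) fejer(1)[OF s]] \<sigma>2 by (simp add: pos_le_divide_eq mult.commute)
qed

section \<open>Large steps and the sum of the stepsizes\<close>

definition growth where
  "growth d = (L0 + Lg \<bullet> \<bar>y 0\<bar>) / 2 + (1/2 + (1/2 + 2 * \<sigma> / 3) / sqrt (1 - \<sigma>\<^sup>2)) * d * norm Lg"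

text \<open>In the equation \<open>quad (yt k) (rho k) = \<theta>\<^sup>2 / lam k\<close> the outer
  factor is replaced by \<open>\<sigma> * n\<close> and the coefficient by its worst case:
  \<open>n \<le> R\<close> and \<open>norm (yt k - y 0) \<le> R + D\<close>. The coefficient
  \<open>growth D\<close> is the constant \<open>c\<close> when \<open>D\<close> is
  \<open>d0\<close>.\<close>

lemma large_step:
  assumes s: "s \<in> KKT" and k: "k \<in> A"
  shows "\<theta>\<^sup>2 \<le> \<sigma> * growth (norm (z 0 - s)) * (lam k * norm (zt k - z (k - 1)))"
proof -
  define n where "n = norm (zt k - z (k - 1))"
  define D where "D = norm (z 0 - s)"
  define R where "R = D / sqrt (1 - \<sigma>\<^sup>2)"
  have k1: "1 \<le> k" and rho: "rho k \<le> \<sigma> * n" using k by (auto simp: A_def rho_def n_def)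
  have n: "0 \<le> n" "n \<le> R" using distances(1)[OF s k] by (auto simp: n_def R_def D_def)
  have "norm (yt k - y 0) \<le> norm (zt k - z 0)"
    using norm_snd_le[of "yt k - y 0" "xt k - x 0"] by (simp add: zt_def z_def)
  also have "\<dots> \<le> norm (zt k - s) + norm (s - z 0)"
    by (rule order_trans[OF _ norm_triangle_ineq]) simp
  also have "\<dots> \<le> R + D" using distances(2)[OF s k] by (simp add: R_def D_def norm_minus_commute)
  finally have yt: "norm (yt k - y 0) \<le> R + D" .
  have "Lg \<bullet> \<bar>yt k\<bar> \<le> Lg \<bullet> \<bar>y 0\<bar> + norm Lg * norm (yt k - y 0)"
    by (rule inner_le_norm_of_nonneg[OF Lg_nonneg])
  also have "\<dots> \<le> Lg \<bullet> \<bar>y 0\<bar> + norm Lg * (R + D)"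
    using yt by (intro add_left_mono mult_left_mono) auto
  finally have Lyt: "Lg \<bullet> \<bar>yt k\<bar> \<le> Lg \<bullet> \<bar>y 0\<bar> + norm Lg * (R + D)" .
  have "\<theta>\<^sup>2 / lam k = quad (yt k) (rho k)" using quad_rho[OF k1] by simp
  also have "\<dots> \<le> quad (yt k) (\<sigma> * n)"
    using rho rho_pos[OF k1] by (intro quad_mono) auto
  also have "\<dots> \<le> ((L0 + (Lg \<bullet> \<bar>y 0\<bar> + norm Lg * (R + D))) / 2 + 2 * norm Lg / 3 * (\<sigma> * R)) * (\<sigma> * n)"
    unfolding quad_def using n \<sigma>_bounds Lyt
    by (intro mult_right_mono add_mono divide_right_mono mult_left_mono) auto
  also have "(L0 + (Lg \<bullet> \<bar>y 0\<bar> + norm Lg * (R + D))) / 2 + 2 * norm Lg / 3 * (\<sigma> * R) = growth D"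
    by (simp add: growth_def R_def add_divide_distrib algebra_simps)
  finally have "\<theta>\<^sup>2 \<le> growth D * (\<sigma> * n) * lam k"
    using lam_pos[OF k1] by (simp add: pos_divide_le_eq)
  then show ?thesis by (simp add: n_def D_def mult_ac)
qed

lemma growth_pos: "0 < d \<Longrightarrow> 0 < growth d"
  unfolding growth_def using \<sigma>_bounds L0_nonneg Lg_pos inner_nonneg_vec[OF Lg_nonneg, of "\<bar>y 0\<bar>"]
  by (intro add_nonneg_pos mult_pos_pos add_pos_pos divide_pos_pos) (auto simp: power_less_one_iff)

text \<open>Large steps convert the Fejer bound into one on the sum of
  \<open>1 / (lam j)\<^sup>2\<close>, and \<open>card_cube_le_sum\<close> converts that into growth
  of the sum of the \<open>lam j\<close>. The estimate stays cubed and squared, free of fractional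
  powers.\<close>

lemma stepsize_sum_bound:
  assumes s: "s \<in> KKT" and D: "D = norm (z 0 - s)" "0 < D" and J: "J k \<noteq> {}"
    and \<eta>: "\<eta> = \<theta>\<^sup>2 / (\<sigma> * growth D)"
  shows "(\<tau> * card (J k)) ^ 3 * (\<eta>\<^sup>2 * (1 - \<sigma>\<^sup>2)) \<le> (\<tau> * sum lam (J k) * D)\<^sup>2"
proof -
  have \<sigma>2: "0 < 1 - \<sigma>\<^sup>2" using \<sigma>_bounds by (simp add: power_less_one_iff)
  have \<eta>0: "0 < \<eta>" using growth_pos[OF D(2)] \<sigma>_bounds \<theta>_bounds by (simp add: \<eta>)
  have "\<eta>\<^sup>2 * (1 / (lam j)\<^sup>2) \<le> (norm (zt j - z (j - 1)))\<^sup>2" if j: "j \<in> J k" for j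
  proof -
    have lam: "0 < lam j" using lam_pos[OF J_pos(1)[OF j]] .
    have "\<eta> \<le> lam j * norm (zt j - z (j - 1))"
      using large_step[OF s J_pos(2)[OF j]] growth_pos[OF D(2)] \<sigma>_bounds
      by (simp add: \<eta> D(1) pos_divide_le_eq mult_ac)
    then have "\<eta>\<^sup>2 \<le> (lam j * norm (zt j - z (j - 1)))\<^sup>2" using \<eta>0 by (intro power_mono) auto
    then show ?thesis using lam by (simp add: power_mult_distrib pos_divide_le_eq mult_ac)
  qed
  then have "\<eta>\<^sup>2 * (\<Sum>j\<in>J k. 1 / (lam j)\<^sup>2) \<le> (\<Sum>j\<in>J k. (norm (zt j - z (j - 1)))\<^sup>2)"
    unfolding sum_distrib_left by (rule sum_mono)
  then have "\<tau> * (1 - \<sigma>\<^sup>2) * (\<eta>\<^sup>2 * (\<Sum>j\<in>J k. 1 / (lam j)\<^sup>2)) \<le> \<tau> * (1 - \<sigma>\<^sup>2) * (\<Sum>j\<in>J k. (norm (zt j - z (j - 1)))\<^sup>2)"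
    using \<tau>_bounds \<sigma>2 by (intro mult_left_mono) auto
  also have "\<dots> \<le> D\<^sup>2" using fejer(2)[OF s] by (simp add: D(1))
  finally have Q: "\<tau> * (1 - \<sigma>\<^sup>2) * (\<eta>\<^sup>2 * (\<Sum>j\<in>J k. 1 / (lam j)\<^sup>2)) \<le> D\<^sup>2" .
  have "(\<tau> * card (J k)) ^ 3 * (\<eta>\<^sup>2 * (1 - \<sigma>\<^sup>2)) = \<tau> ^ 3 * (\<eta>\<^sup>2 * (1 - \<sigma>\<^sup>2)) * real (card (J k)) ^ 3"
    by (simp add: power_mult_distrib)
  also have "\<dots> \<le> \<tau> ^ 3 * (\<eta>\<^sup>2 * (1 - \<sigma>\<^sup>2)) * ((sum lam (J k))\<^sup>2 * (\<Sum>j\<in>J k. 1 / (lam j)\<^sup>2))"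
    using \<tau>_bounds \<sigma>2 lam_pos J_pos(1)
    by (intro mult_left_mono card_cube_le_sum[OF finite_J J]) auto
  also have "\<dots> = (\<tau> * sum lam (J k))\<^sup>2 * (\<tau> * (1 - \<sigma>\<^sup>2) * (\<eta>\<^sup>2 * (\<Sum>j\<in>J k. 1 / (lam j)\<^sup>2)))"
    by (simp add: power2_eq_square power3_eq_cube mult_ac)
  also have "\<dots> \<le> (\<tau> * sum lam (J k))\<^sup>2 * D\<^sup>2"
    using Q by (intro mult_left_mono) auto
  finally show ?thesis by (simp add: power_mult_distrib)
qed

text \<open>\<open>T *\<^sub>R v_erg i\<close> telescopes to \<open>z 0 - z k\<close>, and both end
  points lie within \<open>D\<close> of \<open>s\<close>. For the error, the telescoped inequality
  is evaluated at the ergodic mean, which lies within \<open>P\<close> of \<open>s\<close>.\<close>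

lemma ergodic_certificate:
  assumes s: "s \<in> KKT" and D: "D = norm (z 0 - s)" and J: "J k \<noteq> {}"
    and i: "i = card (J k)" and T: "T = \<tau> * sum lam (J k)"
  shows "0 < T" and "certificate (zt_erg i) (v_erg i) (eps_erg i)"
    and "norm (v_erg i) \<le> 2 * D / T"
    and "eps_erg i \<le> 2 * D\<^sup>2 / (T * sqrt (1 - \<sigma>\<^sup>2))"
proof -
  have \<sigma>2: "0 < 1 - \<sigma>\<^sup>2" using \<sigma>_bounds by (simp add: power_less_one_iff)
  show T0: "0 < T"
    unfolding T using \<tau>_bounds J finite_J lam_pos J_pos(1) by (intro mult_pos_pos sum_pos) auto
  define a where "a j = \<tau> * lam j / T" for j
  have \<Lambda>: "\<Lambda> i = T" using sum_kk[of lam k] by (simp add: \<Lambda>_def i T)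
  have zt_erg: "zt_erg i = (\<Sum>j\<in>J k. a j *\<^sub>R zt j)"
    unfolding zt_erg_def \<Lambda> using sum_kk[of "\<lambda>j. lam j *\<^sub>R zt j" k]
    by (simp add: a_def scaleR_sum_right i)
  have v_erg: "v_erg i = (\<Sum>j\<in>J k. a j *\<^sub>R v j)"
    unfolding v_erg_def \<Lambda> using sum_kk[of "\<lambda>j. lam j *\<^sub>R v j" k]
    by (simp add: a_def scaleR_sum_right i)
  have eps_erg: "eps_erg i = (\<Sum>j\<in>J k. a j * (eps j + (zt j - zt_erg i) \<bullet> (v j - v_erg i)))"
    unfolding eps_erg_def \<Lambda>
    using sum_kk[of "\<lambda>j. lam j * (eps j + (zt j - zt_erg i) \<bullet> (v j - v_erg i))" k]
    by (simp add: a_def sum_distrib_left i mult_ac)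
  have a: "0 \<le> a j" if "j \<in> J k" for j
    using lam_pos[OF J_pos(1)[OF that]] \<tau>_bounds T0 by (simp add: a_def)
  have sum_a: "sum a (J k) = 1"
  proof -
    have "sum a (J k) = T / T"
      unfolding a_def sum_divide_distrib[symmetric] sum_distrib_left[symmetric] T[symmetric] ..
    then show ?thesis using T0 by simp
  qed
  show "certificate (zt_erg i) (v_erg i) (eps_erg i)"
    unfolding eps_erg unfolding zt_erg v_erg
    by (rule certificate_ergodic[OF finite_J a sum_a]) (auto intro: certificate_iterate dest: J_pos)
  have Tv: "T *\<^sub>R v_erg i = z 0 - z k"
    using T0 by (subst z_eq_sum[of k]) (simp add: v_erg a_def scaleR_sum_right)
  have "T * norm (v_erg i) = norm (z 0 - z k)" using T0 by (simp flip: Tv)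
  also have "\<dots> \<le> norm (z 0 - s) + norm (z k - s)"
    by (rule order_trans[OF _ norm_triangle_ineq4]) simp
  also have "\<dots> \<le> 2 * D" using fejer(1)[OF s, of k] by (simp add: D)
  finally show "norm (v_erg i) \<le> 2 * D / T" using T0 by (simp add: pos_le_divide_eq mult.commute)
  define P where "P = D / sqrt (1 - \<sigma>\<^sup>2)"
  define E where "E = norm (z k - s)"
  have E: "0 \<le> E" "E \<le> D" using fejer(1)[OF s] by (auto simp: E_def D)
  have "D * sqrt (1 - \<sigma>\<^sup>2) \<le> D * 1"
    by (intro mult_left_mono) (auto simp: D)
  then have P: "D \<le> P" using \<sigma>2 by (simp add: P_def pos_le_divide_eq)
  have "zt_erg i - s = (\<Sum>j\<in>J k. a j *\<^sub>R (zt j - s))"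
    using sum_a by (simp add: zt_erg scaleR_diff_right sum_subtractf flip: scaleR_left.sum)
  also have "norm \<dots> \<le> (\<Sum>j\<in>J k. norm (a j *\<^sub>R (zt j - s)))" by (rule norm_sum)
  also have "\<dots> \<le> (\<Sum>j\<in>J k. a j * P)"
  proof (rule sum_mono)
    fix j assume j: "j \<in> J k"
    have "a j * norm (zt j - s) \<le> a j * P"
      using distances(2)[OF s J_pos(2)[OF j]] a[OF j] unfolding P_def D by (rule mult_left_mono)
    then show "norm (a j *\<^sub>R (zt j - s)) \<le> a j * P" using a[OF j] by simp
  qed
  finally have za: "norm (s - zt_erg i) \<le> P"
    using sum_a by (simp add: norm_minus_commute flip: sum_distrib_right)
  have "(\<Sum>j\<in>J k. a j *\<^sub>R (zt j - zt_erg i)) = zt_erg i - sum a (J k) *\<^sub>R zt_erg i"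
    by (simp add: scaleR_diff_right sum_subtractf scaleR_left.sum flip: zt_erg)
  then have centered: "(\<Sum>j\<in>J k. a j *\<^sub>R (zt j - zt_erg i)) = 0" by (simp add: sum_a)
  have "eps_erg i = (\<Sum>j\<in>J k. a j * (eps j + (zt j - zt_erg i) \<bullet> v j)) - (\<Sum>j\<in>J k. a j *\<^sub>R (zt j - zt_erg i)) \<bullet> v_erg i"
    by (simp add: eps_erg inner_diff_right inner_sum_left sum_subtractf sum.distrib algebra_simps)
  then have "eps_erg i = (\<Sum>j\<in>J k. a j * (eps j + (zt j - zt_erg i) \<bullet> v j))"
    by (simp add: centered)
  then have "2 * T * eps_erg i = (\<Sum>j\<in>J k. 2 * (\<tau> * lam j) * (v j \<bullet> (zt j - zt_erg i) + eps j))"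
    using T0 by (simp add: a_def sum_distrib_left inner_commute add.commute mult_ac)
  also have "\<dots> \<le> (\<Sum>j\<in>J k. 2 * (\<tau> * lam j) * (v j \<bullet> (zt j - zt_erg i) + eps j)
      + \<tau> * (1 - \<sigma>\<^sup>2) * (norm (zt j - z (j - 1)))\<^sup>2)"
    using \<tau>_bounds \<sigma>2 by (intro sum_mono) simp
  also have "\<dots> \<le> (norm (z 0 - zt_erg i))\<^sup>2 - (norm (z k - zt_erg i))\<^sup>2"
    using telescope[of k "zt_erg i"] by linarith
  also have "\<dots> = 2 * ((z 0 - z k) \<bullet> (s - zt_erg i)) + D\<^sup>2 - E\<^sup>2"
    by (simp add: D E_def power2_norm_eq_inner inner_diff_left inner_diff_right inner_commute)
  also have "\<dots> \<le> 2 * ((D + E) * P) + D\<^sup>2 - E\<^sup>2"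
  proof -
    have "(z 0 - z k) \<bullet> (s - zt_erg i) \<le> norm (z 0 - z k) * norm (s - zt_erg i)"
      by (rule norm_cauchy_schwarz)
    also have "\<dots> \<le> (D + E) * P"
    proof (rule mult_mono)
      show "norm (z 0 - z k) \<le> D + E"
        unfolding D E_def by (rule order_trans[OF _ norm_triangle_ineq4]) simp
    qed (use za E in auto)
    finally show ?thesis by simp
  qed
  also have "\<dots> = 2 * ((D + E) * P) + (D + E) * (D - E)"
    by (simp add: power2_eq_square algebra_simps)
  \<comment> \<open>Replacing \<open>D + E\<close> by \<open>2 * P\<close> makes the unknown
    distance \<open>E\<close> cancel.\<close>
  also have "\<dots> \<le> 2 * ((D + E) * P) + (2 * P) * (D - E)"
    using E P by (intro add_left_mono mult_right_mono) auto
  also have "\<dots> = 4 * (D * P)" by (simp add: algebra_simps)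
  finally have "T * eps_erg i \<le> 2 * (D * P)" by simp
  then have "eps_erg i \<le> 2 * (D * P) / T" using T0 by (simp add: pos_le_divide_eq mult.commute)
  then show "eps_erg i \<le> 2 * D\<^sup>2 / (T * sqrt (1 - \<sigma>\<^sup>2))"
    by (simp add: P_def power2_eq_square mult.commute)
qed

text \<open>Outside \<open>A\<close> the test is reversed and bounds
  \<open>norm (zt k - z (k - 1))\<close> by \<open>rho k / \<sigma>\<close>; together with the
  residual this produces the factor \<open>1 + 1 / \<sigma>\<close>.\<close>

lemma pointwise_bounds:
  assumes k: "1 \<le> k" "k \<notin> A"
  shows "norm (v k) \<le> (1 + 1 / \<sigma>) * rho k / lam k" and "eps k \<le> (rho k)\<^sup>2 / (2 * lam k)"
proof -
  define r where "r = lam k *\<^sub>R v k + zt k - z (k - 1)"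
  have lam: "0 < lam k" and e: "0 \<le> eps k" and rho: "0 < rho k"
    using lam_pos eps_nonneg rho_pos k(1) by auto
  have res: "(norm r)\<^sup>2 + 2 * lam k * eps k \<le> (rho k)\<^sup>2"
    using residual_bound[OF k(1)] by (simp add: r_def)
  then have "2 * lam k * eps k \<le> (rho k)\<^sup>2" using zero_le_power2[of "norm r"] by linarith
  then show "eps k \<le> (rho k)\<^sup>2 / (2 * lam k)" using lam by (simp add: pos_le_divide_eq mult_ac)
  have "(norm r)\<^sup>2 \<le> (rho k)\<^sup>2"
    using res mult_nonneg_nonneg[OF less_imp_le[OF lam] e] by linarith
  then have r: "norm r \<le> rho k" using rho by - (rule power2_le_imp_le, simp_all)
  have "norm (zt k - z (k - 1)) \<le> rho k / \<sigma>"
    using k \<sigma>_bounds by (simp add: A_def rho_def pos_le_divide_eq mult.commute)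
  moreover have "lam k * norm (v k) = norm (r - (zt k - z (k - 1)))"
    using lam by (simp add: r_def)
  ultimately have "lam k * norm (v k) \<le> rho k + rho k / \<sigma>"
    using norm_triangle_ineq4[of r "zt k - z (k - 1)"] r by linarith
  then show "norm (v k) \<le> (1 + 1 / \<sigma>) * rho k / lam k"
    using lam by (simp add: pos_le_divide_eq algebra_simps)
qed

lemma rho_le_quad_root:
  assumes "1 \<le> k" "lam 1 \<le> lam k"
  shows "rho k \<le> quad_root L0 (\<theta>\<^sup>2 / lam 1)"
  unfolding rho_def using lam_pos[OF assms(1)] lam1_pos assms(2) \<theta>_bounds
  by (intro \<rho>_le_quad_root divide_pos_pos divide_left_mono) auto

text \<open>Since each index in \<open>A\<close> cancels one increase, fewer than \<open>m\<close>
  of them among \<open>2 * m + n\<close> leave at least \<open>n\<close> net increases. The last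
  index outside \<open>A\<close> is chosen because all later steps only shrink the stepsize.\<close>

lemma large_stepsize:
  assumes J: "card (J (2 * m + n)) < m"
  shows "\<exists>k. 1 \<le> k \<and> k \<le> 2 * m + n \<and> k \<notin> A \<and> lam 1 * (1 / (1 - \<tau>)) powr real n \<le> lam k"
proof -
  define M where "M = 2 * m + n"
  define k where "k = Max ({1..M} - A)"
  have "{1..M} - A \<noteq> {}"
  proof
    assume "{1..M} - A = {}"
    then have "J M = {1..M}" by (auto simp: J_def)
    then show False using J by (simp add: M_def)
  qed
  then have "k \<in> {1..M} - A" unfolding k_def by (intro Max_in) auto
  then have k: "1 \<le> k" "k \<le> M" "k \<notin> A" by auto
  have above: "j \<in> A" if "k < j" "j \<le> M" for j
  proof (rule ccontr)
    assume "j \<notin> A"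
    then have "j \<le> k" unfolding k_def using that by (intro Max_ge) auto
    then show False using that by simp
  qed
  have "J M = J (k - 1) \<union> {k<..M}"
    using k above by (auto simp: J_def) (metis Suc_pred le_SucE linorder_not_less not_less_eq_eq less_le_trans zero_less_one)
  then have "card (J M) = card (J (k - 1)) + (M - k)"
    by (subst card_Un_disjoint[symmetric, THEN trans[rotated]]) (auto simp: finite_J J_def)
  then have "real n \<le> real (k - 1) - 2 * real (card (J (k - 1)))"
    using J k by (simp add: M_def[symmetric] of_nat_diff) (simp add: M_def)
  then have "(1 / (1 - \<tau>)) powr real n \<le> (1 / (1 - \<tau>)) powr (real (k - 1) - 2 * real (card (J (k - 1))))"
    using \<tau>_bounds by (intro powr_mono) auto
  then have "lam 1 * (1 / (1 - \<tau>)) powr real n \<le> lam k"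
    using lam_Suc_eq[of "k - 1"] k(1) lam1_pos by simp
  then show ?thesis using k by (auto simp: M_def)
qed

end

section \<open>Powers, logarithms and the complexity bound\<close>

lemma powr_two_thirds_cube: "0 \<le> (a::real) \<Longrightarrow> (a powr (2/3)) ^ 3 = a\<^sup>2"
  by (cases "a = 0") (auto simp: powr_powr simp flip: powr_numeral)

lemma exp_log_plus_ge: "0 < t \<Longrightarrow> t \<le> exp (log_plus t)" "1 \<le> exp (log_plus t)"
  by (auto simp: log_plus_def intro: order_trans[OF eq_refl[OF exp_ln[symmetric]]])

theorem theorem7p4:
  fixes f :: "real ^ 'n \<Rightarrow> real" and g :: "real ^ 'n \<Rightarrow> real ^ 'm"
    and L0 :: real and Lg :: "real ^ 'm"
    and \<sigma> \<theta> h \<tau> :: real and lam :: "nat \<Rightarrow> real"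
    and x xt :: "nat \<Rightarrow> real ^ 'n" and y yt :: "nat \<Rightarrow> real ^ 'm"
    and \<delta>bar \<epsilon>bar d0 c \<eta> \<rho>bar :: real and M :: int
  assumes run: "algorithm1 f g L0 Lg \<sigma> \<theta> \<tau> lam x y xt yt h"
    and tolerances: "0 < \<delta>bar" "0 < \<epsilon>bar"
    and d0: "d0 = infdist (x 0, y 0) (convex_program_data.KKT f g)"
    and c: "c = (L0 + Lg \<bullet> \<bar>y 0\<bar>) / 2
              + (1/2 + (1/2 + 2 * \<sigma> / 3) / sqrt (1 - \<sigma>\<^sup>2)) * d0 * norm Lg"
    and \<eta>: "\<eta> = \<theta>\<^sup>2 / (\<sigma> * c)"
    and \<rho>bar: "\<rho>bar = 2 * \<theta>\<^sup>2
              / (lam 1 * (L0 / 2 + sqrt ((L0 / 2)\<^sup>2 + 8 * norm Lg * \<theta>\<^sup>2 / (3 * lam 1))))"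
    and M: "M = 2 * \<lceil>max
                (2 powr (2/3) * d0 powr (4/3)
                  / (\<delta>bar powr (2/3) * \<tau> * (\<eta> * sqrt (1 - \<sigma>)) powr (2/3)))
                (2 powr (2/3) * d0\<^sup>2
                  / (\<epsilon>bar powr (2/3) * \<tau> * (\<eta> * (1 - \<sigma>\<^sup>2)) powr (2/3)))\<rceil>
              + \<lceil>max (log_plus ((1 + 1/\<sigma>) * \<rho>bar / (\<delta>bar * lam 1)))
                     (log_plus (\<rho>bar\<^sup>2 / (2 * \<epsilon>bar * lam 1)))
                  / ln (1 / (1 - \<tau>))\<rceil>"
  shows "\<exists>x' y' p q \<epsilon>.
      ((x', y'), (p, q), \<epsilon>)
        \<in> algorithm1_data.found_within f g L0 Lg \<sigma> \<theta> \<tau> lam x y xt yt M \<and>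
      (p, q) \<in> eps_subdifferential \<epsilon>
        (\<lambda>(u, s). convex_program_data.Lbar f g u y' - convex_program_data.Lbar f g x' s)
        (x', y') \<and>
      norm (p, q) \<le> \<delta>bar \<and> \<epsilon> \<le> \<epsilon>bar \<and>
      p \<in> eps_subdifferential (\<epsilon> + y' \<bullet> (g x' + q))
        (\<lambda>u. convex_program_data.Lbar f g u y') x' \<and>
      g x' + q \<le> 0 \<and> 0 \<le> y' \<and> y' \<bullet> (g x' + q) \<ge> - \<epsilon>"
proof -
  interpret algorithm1 f g L0 Lg \<sigma> \<theta> \<tau> lam x y xt yt h by (rule run)
  define s2 where "s2 = 1 - \<sigma>\<^sup>2"
  have s2: "0 < s2" using \<sigma>_bounds by (simp add: s2_def power_less_one_iff)
  have z0: "z 0 = (x 0, y 0)" by (simp add: z_def)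
  have "z 0 \<notin> KKT" using start_not_KKT unfolding zt_def z_def xt1 yt1 .
  then have d0_pos: "0 < d0"
    unfolding d0 z0 by (intro infdist_pos_not_in_closed KKT_closed KKT_nonempty)
  obtain s where s: "s \<in> KKT" "d0 = norm (z 0 - s)"
    using infdist_attains_inf[OF KKT_closed KKT_nonempty, of "z 0"] by (metis d0 dist_norm z0)
  have c_eq: "c = growth d0" by (simp add: c growth_def)
  have \<eta>_pos: "0 < \<eta>"
    using growth_pos[OF d0_pos] \<sigma>_bounds \<theta>_bounds by (simp add: \<eta> c_eq)
  define X1 where "X1 = 2 powr (2/3) * d0 powr (4/3)
    / (\<delta>bar powr (2/3) * \<tau> * (\<eta> * sqrt (1 - \<sigma>)) powr (2/3))"
  define X2 where "X2 = 2 powr (2/3) * d0\<^sup>2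
    / (\<epsilon>bar powr (2/3) * \<tau> * (\<eta> * (1 - \<sigma>\<^sup>2)) powr (2/3))"
  define t1 where "t1 = (1 + 1/\<sigma>) * \<rho>bar / (\<delta>bar * lam 1)"
  define t2 where "t2 = \<rho>bar\<^sup>2 / (2 * \<epsilon>bar * lam 1)"
  define Y where "Y = max (log_plus t1) (log_plus t2) / ln (1 / (1 - \<tau>))"
  define m where "m = nat \<lceil>max X1 X2\<rceil>"
  define n where "n = nat \<lceil>Y\<rceil>"
  have \<tau>: "0 < \<tau>" "\<tau> < 1" using \<tau>_bounds by auto
  have X1: "0 < X1"
    using d0_pos tolerances \<tau> \<eta>_pos \<sigma>_bounds by (simp add: X1_def)
  have X2: "0 < X2"
    using d0_pos tolerances \<tau> \<eta>_pos s2 by (simp add: X2_def s2_def)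
  have ln_pos: "0 < ln (1 / (1 - \<tau>))" using \<tau> by (intro ln_gt_zero) auto
  have Y: "0 \<le> Y" using ln_pos by (auto simp: Y_def log_plus_def)
  have M_eq: "M = int (2 * m + n)"
  proof -
    have "M = 2 * \<lceil>max X1 X2\<rceil> + \<lceil>Y\<rceil>"
      unfolding M X1_def X2_def Y_def t1_def t2_def ..
    moreover have "0 \<le> \<lceil>max X1 X2\<rceil>" "0 \<le> \<lceil>Y\<rceil>"
      using X1 Y by (simp_all add: less_max_iff_disj)
    ultimately show ?thesis unfolding m_def n_def by simp
  qed
  have m: "0 < m" "X1 \<le> real m" "X2 \<le> real m"
  proof -
    have "0 < max X1 X2" using X1 by (simp add: less_max_iff_disj)
    then have "0 < \<lceil>max X1 X2\<rceil>" by simp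
    then show "0 < m" unfolding m_def by simp
    have "max X1 X2 \<le> real m" unfolding m_def by (rule real_nat_ceiling_ge)
    then show "X1 \<le> real m" "X2 \<le> real m" by auto
  qed
  have n: "Y \<le> real n" unfolding n_def by (rule real_nat_ceiling_ge)
  have "\<exists>p u e. (p, u, e) \<in> found_within M \<and> certificate p u e \<and> norm u \<le> \<delta>bar \<and> e \<le> \<epsilon>bar"
  proof (cases "m \<le> card (J (2 * m + n))")
    case True
    define k where "k = 2 * m + n"
    define i where "i = card (J k)"
    define T where "T = \<tau> * sum lam (J k)"
    have Jk: "J k \<noteq> {}" using True m(1) by (auto simp: k_def)
    note erg = ergodic_certificate[OF s(1) s(2) Jk i_def T_def]
    have T: "(\<tau> * real i) ^ 3 * (\<eta>\<^sup>2 * s2) \<le> (T * d0)\<^sup>2"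
      using stepsize_sum_bound[OF s(1) s(2) d0_pos Jk, of \<eta>] by (simp add: \<eta> c_eq i_def T_def s2_def)
    have i: "X1 \<le> real i" "X2 \<le> real i" using m True by (simp_all add: i_def k_def)
    \<comment> \<open>Cubing clears the exponents 2/3 in \<open>X1\<close> and \<open>X2\<close>,
      leaving squares that are compared by taking roots.\<close>
    have cube: "(\<tau> * X) ^ 3 * (\<eta>\<^sup>2 * s2) \<le> (T * d0)\<^sup>2" if "0 < X" "X \<le> real i" for X
      using that \<tau> \<eta>_pos s2
      by (intro order_trans[OF mult_right_mono[OF power_mono] T] mult_left_mono) auto
    have "norm (v_erg i) \<le> \<delta>bar"
    proof -
      have "(\<tau> * X1) ^ 3 = (2\<^sup>2 * (d0 powr (4/3)) ^ 3) / (\<delta>bar\<^sup>2 * (\<eta> * sqrt (1 - \<sigma>))\<^sup>2)"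
        using \<tau> tolerances \<eta>_pos \<sigma>_bounds
        by (simp add: X1_def power_divide power_mult_distrib powr_two_thirds_cube field_simps)
      also have "(d0 powr (4/3)) ^ 3 = d0 ^ 4"
        using d0_pos by (simp add: powr_powr flip: powr_numeral)
      finally have "(\<tau> * X1) ^ 3 * (\<eta>\<^sup>2 * s2) = (2 * d0\<^sup>2 / \<delta>bar)\<^sup>2 * (s2 / (1 - \<sigma>))"
        using tolerances \<eta>_pos \<sigma>_bounds by (simp add: power_mult_distrib power_divide)
      \<comment> \<open>The quotient is 1 + \<sigma>: the first threshold is stated with 1 -
        \<sigma>, while the stepsize bound provides \<open>s2\<close>.\<close>
      moreover have "1 \<le> s2 / (1 - \<sigma>)"
        using \<sigma>_bounds by (simp add: s2_def pos_le_divide_eq power2_eq_square)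
      then have "(2 * d0\<^sup>2 / \<delta>bar)\<^sup>2 * 1 \<le> (2 * d0\<^sup>2 / \<delta>bar)\<^sup>2 * (s2 / (1 - \<sigma>))"
        by (intro mult_left_mono) auto
      ultimately have "(2 * d0\<^sup>2 / \<delta>bar)\<^sup>2 \<le> (T * d0)\<^sup>2" using cube[OF X1 i(1)] by simp
      then have "2 * d0\<^sup>2 / \<delta>bar \<le> T * d0"
        by (rule power2_le_imp_le) (use erg(1) d0_pos in simp)
      then have "2 * d0 \<le> T * \<delta>bar"
        using d0_pos tolerances by (simp add: pos_divide_le_eq power2_eq_square)
      then have "2 * d0 / T \<le> \<delta>bar" using erg(1) by (simp add: pos_divide_le_eq mult.commute)
      then show ?thesis using erg(3) by simp
    qed
    moreover have "eps_erg i \<le> \<epsilon>bar"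
    proof -
      have "(\<tau> * X2) ^ 3 = (2\<^sup>2 * (d0\<^sup>2) ^ 3) / (\<epsilon>bar\<^sup>2 * (\<eta> * s2)\<^sup>2)"
        using \<tau> tolerances \<eta>_pos s2
        by (simp add: X2_def s2_def[symmetric] power_divide power_mult_distrib powr_two_thirds_cube field_simps)
      then have "(\<tau> * X2) ^ 3 * (\<eta>\<^sup>2 * s2) = (2 * d0 ^ 3 / \<epsilon>bar)\<^sup>2 / s2"
        using tolerances \<eta>_pos s2 by (simp add: power_mult_distrib power_divide power2_eq_square power3_eq_cube)
      also have "\<dots> = (2 * d0 ^ 3 / (\<epsilon>bar * sqrt s2))\<^sup>2"
        using s2 by (simp add: power_mult_distrib power_divide)
      finally have "(2 * d0 ^ 3 / (\<epsilon>bar * sqrt s2))\<^sup>2 \<le> (T * d0)\<^sup>2" using cube[OF X2 i(2)] by simp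
      then have "2 * d0 ^ 3 / (\<epsilon>bar * sqrt s2) \<le> T * d0"
        by (rule power2_le_imp_le) (use erg(1) d0_pos in simp)
      then have "2 * d0\<^sup>2 \<le> T * (\<epsilon>bar * sqrt s2)"
        using d0_pos tolerances s2 by (simp add: pos_divide_le_eq power2_eq_square power3_eq_cube)
      then have "2 * d0\<^sup>2 / (T * sqrt s2) \<le> \<epsilon>bar"
        using erg(1) s2 by (simp add: pos_divide_le_eq mult_ac)
      then show ?thesis using erg(4) by (simp add: s2_def)
    qed
    moreover have "(zt_erg i, v_erg i, eps_erg i) \<in> found_within M"
      using card_J_in_I[OF Jk] unfolding found_within_def M_eq i_def k_def by auto
    ultimately show ?thesis using erg(2) by blast
  next
    case False
    then obtain k where k: "1 \<le> k" "k \<le> 2 * m + n" "k \<notin> A"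
      and lam_ge: "lam 1 * (1 / (1 - \<tau>)) powr real n \<le> lam k"
      using large_stepsize[of m n] by auto
    have lam: "0 < lam 1" "0 < lam k" using lam1_pos lam_pos[OF k(1)] by auto
    have "exp (max (log_plus t1) (log_plus t2)) = (1 / (1 - \<tau>)) powr Y"
      using \<tau> ln_pos by (simp add: powr_def Y_def)
    also have "\<dots> \<le> (1 / (1 - \<tau>)) powr real n" using n \<tau> by (intro powr_mono) auto
    finally have "lam 1 * exp (max (log_plus t1) (log_plus t2)) \<le> lam k"
      using lam_ge lam by (meson mult_left_mono less_imp_le order_trans)
    then have lam_exp: "lam 1 * exp (log_plus t1) \<le> lam k" "lam 1 * exp (log_plus t2) \<le> lam k"
      using lam by (smt (verit) exp_le_cancel_iff max.cobounded1 max.cobounded2 mult_left_mono)+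
    have \<rho>bar_eq: "\<rho>bar = quad_root L0 (\<theta>\<^sup>2 / lam 1)"
      using lam by (simp add: \<rho>bar quad_root_def)
    have "0 < \<theta>\<^sup>2 / lam 1" using lam \<theta>_bounds by simp
    then have \<rho>bar_pos: "0 < \<rho>bar" unfolding \<rho>bar_eq by (rule quad_root(1)[OF L0_nonneg])
    have t: "0 < t1" "0 < t2"
      using \<rho>bar_pos \<sigma>_bounds tolerances lam by (simp_all add: t1_def t2_def add_pos_pos)
    \<comment> \<open>For positive \<open>t\<close>, \<open>exp (log_plus t)\<close> dominates both
      1 and \<open>t\<close>. The value 1 keeps the stepsize above \<open>lam 1\<close>, so that
      \<open>\<rho>bar\<close> applies; \<open>t1\<close> and \<open>t2\<close> encode the two
      tolerances.\<close>
    have ge: "lam 1 * 1 \<le> lam k" "lam 1 * t1 \<le> lam k" "lam 1 * t2 \<le> lam k"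
      using order_trans[OF mult_left_mono[OF exp_log_plus_ge(2)] lam_exp(1)]
        order_trans[OF mult_left_mono[OF exp_log_plus_ge(1)[OF t(1)]] lam_exp(1)]
        order_trans[OF mult_left_mono[OF exp_log_plus_ge(1)[OF t(2)]] lam_exp(2)] lam by auto
    have rho: "0 < rho k" "rho k \<le> \<rho>bar"
      using rho_pos[OF k(1)] rho_le_quad_root[OF k(1)] ge(1) by (auto simp: \<rho>bar_eq)
    have "norm (v k) \<le> \<delta>bar"
    proof -
      have "norm (v k) \<le> (1 + 1 / \<sigma>) * rho k / lam k" by (rule pointwise_bounds(1)[OF k(1,3)])
      also have "\<dots> \<le> (1 + 1 / \<sigma>) * \<rho>bar / lam k"
        using rho lam \<sigma>_bounds by (intro divide_right_mono mult_left_mono) auto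
      also have "\<dots> \<le> \<delta>bar"
        using ge(2) lam tolerances by (simp add: t1_def pos_divide_le_eq mult_ac)
      finally show ?thesis .
    qed
    moreover have "eps k \<le> \<epsilon>bar"
    proof -
      have "eps k \<le> (rho k)\<^sup>2 / (2 * lam k)" by (rule pointwise_bounds(2)[OF k(1,3)])
      also have "\<dots> \<le> \<rho>bar\<^sup>2 / (2 * lam k)"
        using rho lam by (intro divide_right_mono power_mono) auto
      also have "\<dots> \<le> \<epsilon>bar"
        using ge(3) lam tolerances by (simp add: t2_def pos_divide_le_eq mult_ac)
      finally show ?thesis .
    qed
    moreover have "(zt k, v k, eps k) \<in> found_within M"
      using k unfolding found_within_def M_eq by auto
    ultimately show ?thesis using certificate_iterate[OF k(1)] by blast
  qed
  then obtain x' y' p q \<epsilon> where found: "((x', y'), (p, q), \<epsilon>) \<in> found_within M"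
    and cert: "certificate (x', y') (p, q) \<epsilon>" and "norm (p, q) \<le> \<delta>bar" "\<epsilon> \<le> \<epsilon>bar"
    by (metis surj_pair)
  then show ?thesis
    using certificate_subdifferential[OF cert] certificate_componentwise[OF cert] by blast
qed

end
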